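(* Let $k\ge4$ be even and let $\mathbf{a}=(a_1,\dots,a_k)$ be a symmetric tuple of integers with $a_1<\cdots<a_k$. Suppose there is a function $r\colon\mathbb{Z}_{\ge1}\to\mathbb{Z}_{\ge1}$ with $\log r(N)/\log N\to0$ as $N\to\infty$ such that for every $N$ there is a coloring of $[N]=\{1,\dots,N\}$ with $r(N)$ colors and no symmetrically colored $\mathbf{a}$-AP. Then for every $C>0$, $\rho_{\mathbf{a}}(\alpha)<\alpha^C$ for all sufficiently small $\alpha>0$.
   Context: $\mathbf{a}$ is symmetric if $k$ is even and $a_1+a_k=a_2+a_{k-1}=\cdots$. An $\mathbf{a}$-AP is a sequence $n+a_1d,\dots,n+a_kd$; it is symmetrically colored (with all terms in $[N]$ and $d\ne0$) if $n+a_id$ and $n+a_{k-i+1}d$ have the same color for each $i=1,\dots,k/2$. For a finite abelian group $G$ and $f\colon G\to\mathbb{C}$, $\Lambda_{\mathbf{a}}(f)=\mathbb{E}_{n,d\in G}\prod_{i=1}^kf(n+a_id)$; $\partial_hf(n)=f(n)\overline{f(n-h)}$ and $\|f\|_{U^s}^{2^s}=\mathbb{E}_{n,h_1,\dots,h_s}\partial_{h_1}\cdots\partial_{h_s}f(n)$. For $0<\alpha<1$, $\rho_{\mathbf{a}}(\alpha)$ is the largest real number such that for every $\epsilon>0$ there exist $\eta>0$ and $N_0$ such that whenever $N\ge N_0$ and $A\subset\mathbb{Z}/N\mathbb{Z}$ satisfies $\|1_A-\alpha\|_{U^{k-2}}\le\eta$, then $\Lambda_{\mathbf{a}}(1_A)\ge\rho_{\mathbf{a}}(\alpha)-\epsilon$.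 *)

theory Defs
  imports
    "HOL-Analysis.Analysis"
    "HOL-Algebra.Elementary_Groups"
begin

text \<open>
  A tuple \<open>(a\<^sub>1, \<dots>, a\<^sub>k)\<close> is a list of integers of length \<open>k\<close>. List positions
  start at \<open>0\<close>, so the partner of position \<open>i\<close> is \<open>k - 1 - i\<close>.
\<close>

definition symmetric_tuple :: "int list \<Rightarrow> bool" where
  "symmetric_tuple a \<longleftrightarrow>
     even (length a) \<and> (\<exists>s. \<forall>i<length a. a ! i + a ! (length a - 1 - i) = s)"

definition sym_colored_AP :: "int list \<Rightarrow> (int \<Rightarrow> nat) \<Rightarrow> nat \<Rightarrow> int \<Rightarrow> int \<Rightarrow> bool" where
  "sym_colored_AP a c N n d \<longleftrightarrow>
     d \<noteq> 0 \<and>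
     (\<forall>i<length a. n + a ! i * d \<in> {1..int N}) \<and>
     (\<forall>i<length a div 2. c (n + a ! i * d) = c (n + a ! (length a - 1 - i) * d))"

text \<open>Finite abelian groups are in the multiplicative notation of HOL-Algebra: \<open>n + a d\<close>
  is \<open>n \<otimes> d [^] a\<close> and \<open>n - h\<close> is \<open>n \<otimes> inv h\<close>.\<close>

definition AP_count :: "('g, 'm) monoid_scheme \<Rightarrow> int list \<Rightarrow> ('g \<Rightarrow> complex) \<Rightarrow> complex" where
  "AP_count G a f =
     (\<Sum>n\<in>carrier G. \<Sum>d\<in>carrier G. \<Prod>i<length a. f (n \<otimes>\<^bsub>G\<^esub> d [^]\<^bsub>G\<^esub> (a ! i)))
       / of_nat (card (carrier G)) ^ 2"

definition mult_deriv :: "('g, 'm) monoid_scheme \<Rightarrow> 'g \<Rightarrow> ('g \<Rightarrow> complex) \<Rightarrow> 'g \<Rightarrow> complex" where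
  "mult_deriv G h f = (\<lambda>n. f n * cnj (f (n \<otimes>\<^bsub>G\<^esub> inv\<^bsub>G\<^esub> h)))"

text \<open>The list \<open>hs\<close> is \<open>(h\<^sub>1, \<dots>, h\<^sub>s)\<close>. For \<open>s \<ge> 1\<close> the average is a nonnegative
  real number, so that taking \<open>Re\<close> loses nothing.\<close>

definition gowers_norm :: "('g, 'm) monoid_scheme \<Rightarrow> nat \<Rightarrow> ('g \<Rightarrow> complex) \<Rightarrow> real" where
  "gowers_norm G s f =
     root (2 ^ s) (Re (
       (\<Sum>n\<in>carrier G. \<Sum>hs\<in>{hs. set hs \<subseteq> carrier G \<and> length hs = s}.
          foldr (mult_deriv G) hs f n)
       / of_nat (card (carrier G)) ^ (s + 1)))"

text \<open>\<open>AP_lower_bound a \<alpha> \<rho>\<close> says that \<open>\<rho>\<close> is admissible in the definition of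
  \<open>\<rho>\<^sub>a(\<alpha>)\<close>. For the indicator of a set, \<open>AP_count\<close> is a real number.\<close>

definition AP_lower_bound :: "int list \<Rightarrow> real \<Rightarrow> real \<Rightarrow> bool" where
  "AP_lower_bound a \<alpha> \<rho> \<longleftrightarrow>
     (\<forall>\<epsilon>>0. \<exists>\<eta>>0. \<exists>N\<^sub>0. \<forall>N\<ge>N\<^sub>0. \<forall>A \<subseteq> carrier (integer_mod_group N).
        gowers_norm (integer_mod_group N) (length a - 2)
            (\<lambda>x. indicator A x - complex_of_real \<alpha>) \<le> \<eta> \<longrightarrow>
        Re (AP_count (integer_mod_group N) a (indicator A)) \<ge> \<rho> - \<epsilon>)"

definition rho :: "int list \<Rightarrow> real \<Rightarrow> real" where
  "rho a \<alpha> = (GREATEST \<rho>. AP_lower_bound a \<alpha> \<rho>)"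

end

theory Submission
  imports Defs "HOL-Real_Asymp.Real_Asymp"
begin

text \<open>
  Write \<open>s = k - 2\<close>. A polynomial of degree \<open>s\<close> satisfies one linear relation
  \<open>\<Sum> c\<^sub>i P(n + a\<^sub>i d) = 0\<close> along an \<open>a\<close>-AP, the divided difference of order \<open>k - 1\<close>. Take
  \<open>N = Q p\<close> with \<open>Q\<close> fixed and \<open>p\<close> a large prime, and let \<open>A\<close> consist of the \<open>x\<close> for which
  \<open>x\<^sup>s mod p\<close> lies in an interval of length \<open>\<alpha> p\<close> starting at \<open>g(x) p / T\<close>, where \<open>g\<close> depends only on
  \<open>x mod Q\<close>. The phase \<open>x\<^sup>s / p\<close> is invisible to the \<open>U\<^sup>s\<close>-norm, so \<open>A\<close> is uniform of density \<open>\<alpha>\<close>,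
  while an \<open>a\<close>-AP in \<open>A\<close> forces \<open>\<Sum> c\<^sub>i g(n + a\<^sub>i d) \<equiv> 0 mod T\<close>.

  The function \<open>g\<close> encodes a color of \<open>x mod Q\<close> on a moment curve, so that this congruence makes the
  sum of the \<open>c\<^sub>i\<close> over each color class vanish. The color records, for suitable dilated residues
  \<open>y\<^sub>0, \<dots>, y\<^sub>D\<close> of \<open>x\<close>: the given color of \<open>y\<^sub>0\<close>, the norm \<open>y\<^sub>1\<^sup>2 + \<cdots> + y\<^sub>D\<^sup>2\<close> as in Behrend's
  construction, and the rough location of each residue. Since no \<open>c\<^sub>i\<close> vanishes there are no singleton
  classes, and since no proper partial sum vanishes the locations force the residues to form
  progressions of integers. On such a progression the norm is quadratic, so the classes are pairs
  reflected about a common center, and the AP is symmetrically colored, which is impossible unless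
  \<open>d\<close> is degenerate. The number of colors is a small power of \<open>Q\<close>, so degenerate \<open>d\<close> have density
  smaller than any fixed power of \<open>\<alpha>\<close>.
\<close>

subsection \<open>Exponential sums and functions missing a coordinate\<close>

definition e_mod :: "nat \<Rightarrow> int \<Rightarrow> complex" where
  "e_mod p x = cis (2 * pi * of_int x / of_nat p)"

lemma e_mod_add: "e_mod p (x + y) = e_mod p x * e_mod p y"
  by (simp add: e_mod_def cis_mult add_divide_distrib distrib_left)

lemma e_mod_0 [simp]: "e_mod p 0 = 1"
  by (simp add: e_mod_def)

lemma norm_e_mod [simp]: "norm (e_mod p x) = 1"
  by (simp add: e_mod_def)

lemma cnj_e_mod: "cnj (e_mod p x) = e_mod p (- x)"
  by (simp add: e_mod_def cis_cnj)

lemma e_mod_power: "e_mod p (int m * x) = e_mod p x ^ m"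
  by (induction m) (auto simp: e_mod_add distrib_right)

lemma e_mod_multiple: "p > 0 \<Longrightarrow> e_mod p (int p * x) = 1"
  using cis_multiple_2pi[of "of_int x"] by (simp add: e_mod_def mult.assoc)

lemma e_mod_mod: "p > 0 \<Longrightarrow> e_mod p (x mod int p) = e_mod p x"
  by (metis e_mod_add e_mod_multiple mod_mult_div_eq mult.right_neutral)

lemma norm_one_minus_cis: "norm (1 - cis t) = 2 * \<bar>sin (t / 2)\<bar>"
proof -
  have "1 - cis t = cis (t / 2) * (cis (- (t / 2)) - cis (t / 2))"
    by (simp add: algebra_simps cis_mult)
  also have "cis (- (t / 2)) - cis (t / 2) = - (2 * \<i> * of_real (sin (t / 2)))"
    by (simp add: complex_eq_iff)
  finally show ?thesis by (simp add: norm_mult)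
qed

text \<open>Jordan's inequality: sine is concave on \<open>{0..pi}\<close>, so it lies above its
  chord from \<open>0\<close> to \<open>pi / 2\<close>.\<close>

lemma sin_ge_linear:
  assumes "0 \<le> u" "u \<le> 1"
  shows "sin (u * (pi / 2)) \<ge> u"
proof -
  have "convex_on {0..pi} (\<lambda>x. - sin x)"
    by (rule f''_ge0_imp_convex[where f' = "\<lambda>x. - cos x" and f'' = sin])
      (auto intro!: derivative_eq_intros sin_ge_zero)
  from convex_onD[OF this, of u 0 "pi / 2"] assms show ?thesis
    by (simp add: algebra_simps)
qed

text \<open>The left side bounds a Fourier coefficient of an interval at frequency \<open>x\<close>.
  The nearer of \<open>0\<close> and \<open>p\<close> gives the estimate; adding the other
  reciprocal makes the bound uniform, and over all frequencies it sums to two harmonic sums.\<close>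

lemma sin_pi_fraction_ge:
  assumes "0 < x" "x < p"
  shows "1 / (p * sin (pi * x / p)) \<le> 1 / x + 1 / (p - x :: real)"
proof (cases "2 * x \<le> p")
  case True
  have "sin ((2 * x / p) * (pi / 2)) \<ge> 2 * x / p"
    using assms True by (intro sin_ge_linear) (auto simp: field_simps)
  also have "(2 * x / p) * (pi / 2) = pi * x / p" by simp
  finally have "p * sin (pi * x / p) \<ge> x" using assms by (simp add: field_simps)
  then have "1 / (p * sin (pi * x / p)) \<le> 1 / x"
    using assms by (intro divide_left_mono) auto
  also have "\<dots> \<le> 1 / x + 1 / (p - x)" using assms by simp
  finally show ?thesis .
next
  case False
  have "sin ((2 * (p - x) / p) * (pi / 2)) \<ge> 2 * (p - x) / p"
    using assms False by (intro sin_ge_linear) (auto simp: field_simps)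
  also have "(2 * (p - x) / p) * (pi / 2) = pi - pi * x / p" using assms by (simp add: field_simps)
  also have "sin (pi - pi * x / p) = sin (pi * x / p)" by simp
  finally have "p * sin (pi * x / p) \<ge> p - x" using assms by (simp add: field_simps)
  then have "1 / (p * sin (pi * x / p)) \<le> 1 / (p - x)"
    using assms by (intro divide_left_mono) auto
  also have "\<dots> \<le> 1 / x + 1 / (p - x)" using assms by simp
  finally show ?thesis .
qed

lemma e_mod_eq_1_iff:
  assumes "p > 0"
  shows "e_mod p x = 1 \<longleftrightarrow> int p dvd x"
proof
  assume "int p dvd x"
  then show "e_mod p x = 1" using assms e_mod_multiple by (auto elim!: dvdE)
next
  assume eq: "e_mod p x = 1"
  define y where "y = x mod int p"
  have y: "e_mod p y = 1" "0 \<le> y" "y < int p"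
    using assms eq by (auto simp: y_def e_mod_mod)
  have "y = 0"
  proof (rule ccontr)
    assume "y \<noteq> 0"
    \<comment> \<open>The half-angle of a nonzero reduced residue lies strictly between
      \<open>0\<close> and \<open>pi\<close>, so the chord from \<open>1\<close> to
      \<open>e_mod p y\<close> has positive length.\<close>
    have "sin (pi * of_int y / of_nat p) > 0"
      using y \<open>y \<noteq> 0\<close> assms by (intro sin_gt_zero) (auto simp: field_simps)
    moreover have "norm (1 - e_mod p y) = 2 * \<bar>sin (pi * of_int y / of_nat p)\<bar>"
      unfolding e_mod_def norm_one_minus_cis by simp
    ultimately show False using y by simp
  qed
  then show "int p dvd x" by (auto simp: y_def)
qed

lemma sum_e_mod:
  assumes "p > 0"
  shows "(\<Sum>t<p. e_mod p (int t * x)) = (if int p dvd x then of_nat p else 0)"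
proof (cases "int p dvd x")
  case True
  then have "e_mod p (int t * x) = 1" for t using assms by (simp add: e_mod_eq_1_iff)
  then show ?thesis using True by simp
next
  case False
  then have "e_mod p x \<noteq> 1" using assms by (simp add: e_mod_eq_1_iff)
  then have "(\<Sum>t<p. e_mod p x ^ t) = (e_mod p x ^ p - 1) / (e_mod p x - 1)"
    by (rule geometric_sum)
  also have "e_mod p x ^ p = 1" using assms by (metis e_mod_multiple e_mod_power)
  finally show ?thesis using False by (simp add: e_mod_power)
qed

text \<open>A geometric sum whose numerator has modulus at most \<open>2\<close>. The bound depends
  on neither \<open>l\<close> nor \<open>m\<close>, so it survives letting the interval vary with
  the residue class modulo \<open>Q\<close>.\<close>

lemma norm_sum_e_mod_interval:
  fixes l :: int
  assumes "0 < x" "x < p"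
  shows "norm (\<Sum>t<m. e_mod p (- int x * (l + int t))) \<le> 1 / sin (pi * real x / real p)"
proof -
  let ?z = "e_mod p (- int x)"
  have s: "sin (pi * real x / real p) > 0"
    using assms by (intro sin_gt_zero) (auto simp: field_simps)
  have n: "norm (?z - 1) = 2 * sin (pi * real x / real p)"
    using s unfolding e_mod_def norm_minus_commute[of _ 1] norm_one_minus_cis by simp
  then have z: "?z \<noteq> 1" using s by auto
  have eq: "- int x * (l + int t) = - int x * l + int t * (- int x)" for t by (simp add: algebra_simps)
  have "(\<Sum>t<m. e_mod p (- int x * (l + int t))) = e_mod p (- int x * l) * (\<Sum>t<m. ?z ^ t)"
    unfolding eq e_mod_add e_mod_power by (simp only: sum_distrib_left)
  also have "norm \<dots> = norm (?z ^ m - 1) / norm (?z - 1)"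
    by (simp only: geometric_sum[OF z] norm_mult norm_divide norm_e_mod mult_1_left)
  also have "\<dots> \<le> 2 / norm (?z - 1)"
    using norm_triangle_ineq4[of "?z ^ m" 1] by (intro divide_right_mono) (auto simp: norm_power)
  finally show ?thesis by (simp add: n)
qed

section \<open>Sums over tuples of shifts\<close>

lemma sum_lists_Suc:
  assumes "finite A"
  shows "(\<Sum>hs\<in>{hs. set hs \<subseteq> A \<and> length hs = Suc s}. F hs) =
    (\<Sum>h\<in>A. \<Sum>hs\<in>{hs. set hs \<subseteq> A \<and> length hs = s}. F (h # hs))"
proof -
  have "{hs. set hs \<subseteq> A \<and> length hs = Suc s} =
      (\<lambda>(h, hs). h # hs) ` (A \<times> {hs. set hs \<subseteq> A \<and> length hs = s})"
    by (auto simp: length_Suc_conv image_iff)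
  then have "(\<Sum>hs\<in>{hs. set hs \<subseteq> A \<and> length hs = Suc s}. F hs) =
      (\<Sum>(h, hs)\<in>A \<times> {hs. set hs \<subseteq> A \<and> length hs = s}. F (h # hs))"
    by (simp add: sum.reindex inj_on_def case_prod_unfold)
  then show ?thesis by (simp add: sum.cartesian_product)
qed

text \<open>A function of \<open>s\<close> variables satisfies the following predicate when it is a product
  \<open>B\<^sub>1 \<cdots> B\<^sub>s\<close> of functions bounded by 1 such that \<open>B\<^sub>i\<close> does not depend on the \<open>i\<close>-th variable.\<close>

fun lower_complexity :: "nat \<Rightarrow> (int list \<Rightarrow> complex) \<Rightarrow> bool" where
  "lower_complexity 0 b \<longleftrightarrow> b [] = 1"
| "lower_complexity (Suc s) b \<longleftrightarrow>
     (\<exists>u v. (\<forall>hs. length hs = s \<longrightarrow> norm (u hs) \<le> 1) \<and> (\<forall>h. lower_complexity s (v h)) \<and>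
            (\<forall>h hs. length hs = s \<longrightarrow> b (h # hs) = u hs * v h hs))"

lemma norm_lower_complexity:
  "lower_complexity s b \<Longrightarrow> length hs = s \<Longrightarrow> norm (b hs) \<le> 1"
proof (induction s arbitrary: b hs)
  case (Suc s)
  then obtain u v where uv: "\<And>hs. length hs = s \<Longrightarrow> norm (u hs) \<le> 1" "\<And>h. lower_complexity s (v h)"
    "\<And>h hs. length hs = s \<Longrightarrow> b (h # hs) = u hs * v h hs" by auto
  from Suc.prems obtain h hs' where hs: "hs = h # hs'" "length hs' = s" by (cases hs) auto
  show ?case using uv(1)[of hs'] Suc.IH[OF uv(2), of hs' h] hs
    by (simp add: uv(3) norm_mult mult_le_one)
qed auto

lemma lower_complexity_mult:
  "lower_complexity s b \<Longrightarrow> lower_complexity s b' \<Longrightarrow> lower_complexity s (\<lambda>hs. b hs * b' hs)"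
proof (induction s arbitrary: b b')
  case (Suc s)
  obtain u v where uv: "\<And>hs. length hs = s \<Longrightarrow> norm (u hs) \<le> 1" "\<And>h. lower_complexity s (v h)"
    "\<And>h hs. length hs = s \<Longrightarrow> b (h # hs) = u hs * v h hs" using Suc.prems(1) by auto
  obtain u' v' where uv': "\<And>hs. length hs = s \<Longrightarrow> norm (u' hs) \<le> 1" "\<And>h. lower_complexity s (v' h)"
    "\<And>h hs. length hs = s \<Longrightarrow> b' (h # hs) = u' hs * v' h hs" using Suc.prems(2) by auto
  show ?case unfolding lower_complexity.simps
  proof (intro exI conjI allI impI)
    show "norm (u hs * u' hs) \<le> 1" if "length hs = s" for hs
      using uv(1)[OF that] uv'(1)[OF that] by (simp add: norm_mult mult_le_one)
    show "lower_complexity s (\<lambda>hs. v h hs * v' h hs)" for h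
      by (rule Suc.IH) (use uv(2) uv'(2) in auto)
    show "b (h # hs) * b' (h # hs) = (u hs * u' hs) * (v h hs * v' h hs)" if "length hs = s" for h hs
      using that by (simp add: uv(3) uv'(3))
  qed
qed auto

lemma lower_complexity_cnj: "lower_complexity s b \<Longrightarrow> lower_complexity s (\<lambda>hs. cnj (b hs))"
proof (induction s arbitrary: b)
  case (Suc s)
  obtain u v where uv: "\<And>hs. length hs = s \<Longrightarrow> norm (u hs) \<le> 1" "\<And>h. lower_complexity s (v h)"
    "\<And>h hs. length hs = s \<Longrightarrow> b (h # hs) = u hs * v h hs" using Suc.prems(1) by auto
  show ?case unfolding lower_complexity.simps
    by (rule exI[of _ "\<lambda>hs. cnj (u hs)"], rule exI[of _ "\<lambda>h hs. cnj (v h hs)"])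
      (use uv Suc.IH in auto)
qed auto

text \<open>Classes modulo \<open>Q\<close> are separated because a \<open>Q\<close>-periodic weight
  is constant on each of them, while the inner sum runs over a complete system modulo
  \<open>p\<close> when \<open>Q\<close> and \<open>p\<close> are coprime.\<close>

lemma sum_int_periodic_split:
  "(\<Sum>h\<in>{0..<int (Q * p)}. f h) = (\<Sum>\<kappa><Q. \<Sum>t<p. f (int \<kappa> + int Q * int t))"
proof -
  have "(\<Sum>h\<in>{0..<int (Q * p)}. f h) = (\<Sum>h<p * Q. f (int h))"
    by (rule sum.reindex_bij_witness[of _ int nat])
      (auto simp: mult.commute nat_less_iff simp flip: of_nat_mult)
  also have "\<dots> = (\<Sum>t<p. \<Sum>h\<in>{t * Q..<t * Q + Q}. f (int h))"
    by (rule sum.nat_group[symmetric])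
  also have "\<dots> = (\<Sum>t<p. \<Sum>\<kappa><Q. f (int \<kappa> + int Q * int t))"
  proof (rule sum.cong[OF refl])
    fix t
    show "(\<Sum>h\<in>{t * Q..<t * Q + Q}. f (int h)) = (\<Sum>\<kappa><Q. f (int \<kappa> + int Q * int t))"
      by (rule sum.reindex_bij_witness[of _ "\<lambda>\<kappa>. \<kappa> + t * Q" "\<lambda>h. h - t * Q"])
        (auto simp: algebra_simps of_nat_diff)
  qed
  also have "\<dots> = (\<Sum>\<kappa><Q. \<Sum>t<p. f (int \<kappa> + int Q * int t))" by (rule sum.swap)
  finally show ?thesis .
qed

lemma periodic_mult:
  fixes w :: "int \<Rightarrow> 'a"
  assumes "\<And>x. w (x + int Q) = w x"
  shows "w (x + int Q * t) = w x"
proof -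
  have n: "w (x + int Q * int m) = w x" for x m
  proof (induction m)
    case (Suc m)
    then show ?case using assms[of "x + int Q * int m"] by (simp add: algebra_simps)
  qed simp
  show ?thesis
  proof (cases "t \<ge> 0")
    case True
    then show ?thesis using n[of x "nat t"] by simp
  next
    case False
    then show ?thesis using n[of "x + int Q * t" "nat (- t)"] by simp
  qed
qed

text \<open>For fixed \<open>h\<close> these are the diagonal terms after Cauchy-Schwarz: the shifts
  of \<open>h mod p\<close> by multiples of \<open>p\<close>, a proportion \<open>1 / p\<close> of
  the range.\<close>

lemma card_congruent_multiple:
  fixes h :: int
  assumes "p > 0"
  shows "card {h'\<in>{0..<int (Q * p)}. int p dvd h - h'} = Q"
proof -
  have "{h'\<in>{0..<int (Q * p)}. int p dvd h - h'} = (\<lambda>i. h mod int p + int p * int i) ` {..<Q}"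
  proof (intro equalityI subsetI)
    fix x assume x: "x \<in> {h'\<in>{0..<int (Q * p)}. int p dvd h - h'}"
    then have "h mod int p = x mod int p" by (simp add: mod_eq_dvd_iff)
    then have eq: "x = h mod int p + int p * int (nat (x div int p))"
      using x assms by (simp add: pos_imp_zdiv_nonneg_iff)
    have "x div int p * int p \<le> x"
      using div_mult_mod_eq[of x "int p"] pos_mod_sign[of "int p" x] assms by linarith
    then have "x div int p * int p < int Q * int p" using x by auto
    then have "x div int p < int Q" using assms by simp
    have "0 \<le> x div int p" using x assms by (simp add: pos_imp_zdiv_nonneg_iff)
    then have "nat (x div int p) < Q" using \<open>x div int p < int Q\<close> by linarith
    then show "x \<in> (\<lambda>i. h mod int p + int p * int i) ` {..<Q}"
      by (intro image_eqI[where x = "nat (x div int p)"]) (use eq in simp_all)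
  next
    fix x assume "x \<in> (\<lambda>i. h mod int p + int p * int i) ` {..<Q}"
    then obtain i where i: "i < Q" "x = h mod int p + int p * int i" by auto
    have "x < int p + int p * int i" using assms by (simp add: i)
    also have "\<dots> = int p * (int i + 1)" by (simp add: algebra_simps)
    also have "\<dots> \<le> int p * int Q" using i by (intro mult_left_mono) auto
    finally have "x < int (Q * p)" by (simp add: mult.commute)
    moreover have "int p dvd h - x" unfolding i by (simp add: mod_eq_dvd_iff[symmetric])
    ultimately show "x \<in> {h'\<in>{0..<int (Q * p)}. int p dvd h - h'}" using assms by (simp add: i)
  qed
  then show ?thesis using assms by (simp add: card_image inj_on_def)
qed

text \<open>Cauchy--Schwarz in one variable turns the product of \<open>s + 1\<close> variables into \<open>h - h'\<close> times
  the product of the other \<open>s\<close>, and removes the factor independent of that variable.\<close>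

lemma multilinear_exponential_sum_bound:
  assumes p: "prime p" and Q: "coprime p Q" "Q > 0" and N: "N = Q * p" and s: "s \<ge> 1"
    and b: "lower_complexity s b"
    and w: "\<And>x. norm (w x) \<le> 1" "\<And>x. w (x + int Q) = w x"
    and lam: "\<not> int p dvd \<mu>"
  shows "norm (\<Sum>hs\<in>{hs. set hs \<subseteq> {0..<int N} \<and> length hs = s}.
           e_mod p (\<mu> * prod_list hs) * w (sum_list hs) * b hs) \<le> 2 * real p powr (- 1 / 2 ^ s) * real N ^ s"
  using s b w lam
proof (induction s arbitrary: b w \<mu> rule: nat_induct_at_least)
  case base
  have p0: "p > 0" using p prime_gt_0_nat by blast
  \<comment> \<open>A step by \<open>Q\<close> inside a residue class changes the phase by
    \<open>\<mu> * Q\<close>, still nonzero modulo \<open>p\<close>; this makes the inner sum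
    vanish.\<close>
  have nd: "\<not> int p dvd \<mu> * int Q"
    using base.prems(4) p Q(1) by (metis coprime_dvd_mult_left_iff coprime_int_iff)
  obtain u v where uv: "\<And>h. v h [] = 1" "\<And>h. b [h] = u [] * v h []"
    using base.prems(1) by auto
  have "(\<Sum>hs\<in>{hs. set hs \<subseteq> {0..<int N} \<and> length hs = 1}. e_mod p (\<mu> * prod_list hs) * w (sum_list hs) * b hs)
      = (\<Sum>h\<in>{0..<int N}. e_mod p (\<mu> * h) * w h * b [h])"
  proof -
    have "{hs. set hs \<subseteq> {0..<int N} \<and> length hs = 0} = {[]}" by auto
    then show ?thesis unfolding One_nat_def by (subst sum_lists_Suc) (simp_all del: length_0_conv)
  qed
  \<comment> \<open>With a single variable, a factor missing that variable is a constant.\<close>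
  also have "\<dots> = (\<Sum>h\<in>{0..<int N}. e_mod p (\<mu> * h) * w h * u [])" by (simp add: uv)
  also have "\<dots> = (\<Sum>\<kappa><Q. \<Sum>t<p. e_mod p (\<mu> * (int \<kappa> + int Q * int t)) * w (int \<kappa> + int Q * int t) * u [])"
    unfolding N by (rule sum_int_periodic_split)
  also have "\<dots> = (\<Sum>\<kappa><Q. \<Sum>t<p. (e_mod p (\<mu> * int \<kappa>) * w (int \<kappa>) * u []) * e_mod p (int t * (\<mu> * int Q)))"
  proof (intro sum.cong refl)
    fix \<kappa> t
    have "e_mod p (\<mu> * (int \<kappa> + int Q * int t)) = e_mod p (\<mu> * int \<kappa>) * e_mod p (int t * (\<mu> * int Q))"
      unfolding e_mod_add[symmetric] by (simp add: algebra_simps)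
    then show "e_mod p (\<mu> * (int \<kappa> + int Q * int t)) * w (int \<kappa> + int Q * int t) * u [] =
        (e_mod p (\<mu> * int \<kappa>) * w (int \<kappa>) * u []) * e_mod p (int t * (\<mu> * int Q))"
      by (simp only: periodic_mult[of w Q, OF base.prems(3)] mult_ac)
  qed
  also have "\<dots> = (\<Sum>\<kappa><Q. (e_mod p (\<mu> * int \<kappa>) * w (int \<kappa>) * u []) * (\<Sum>t<p. e_mod p (int t * (\<mu> * int Q))))"
    by (simp only: sum_distrib_left)
  also have "\<dots> = 0" using nd p0 by (simp add: sum_e_mod)
  finally show ?case by simp
next
  case (Suc s)
  let ?L = "{hs. set hs \<subseteq> {0..<int N} \<and> length hs = s}"
  let ?I = "{0..<int N}"
  define \<epsilon> where "\<epsilon> = real p powr (- 1 / 2 ^ s)"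
  have p0: "p > 0" "p > 1" using p prime_gt_0_nat prime_gt_1_nat by blast+
  have finL: "finite ?L" and cardL: "card ?L = N ^ s"
    using finite_lists_length_eq[of ?I s] card_lists_length_eq[of ?I s] by auto
  obtain u v where uv: "\<And>hs. length hs = s \<Longrightarrow> norm (u hs) \<le> 1" "\<And>h. lower_complexity s (v h)"
    "\<And>h hs. length hs = s \<Longrightarrow> b (h # hs) = u hs * v h hs" using Suc.prems(1) by auto
  define Y where "Y h hs = e_mod p (\<mu> * (h * prod_list hs)) * w (h + sum_list hs) * v h hs" for h hs
  define S where "S hs = (\<Sum>h\<in>?I. Y h hs)" for hs
  define X where "X = (\<Sum>hs\<in>{hs. set hs \<subseteq> ?I \<and> length hs = Suc s}.
    e_mod p (\<mu> * prod_list hs) * w (sum_list hs) * b hs)"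
  have "X = (\<Sum>h\<in>?I. \<Sum>hs\<in>?L. u hs * Y h hs)"
    unfolding X_def by (subst sum_lists_Suc) (auto intro!: sum.cong simp: Y_def uv(3))
  also have "\<dots> = (\<Sum>hs\<in>?L. u hs * S hs)"
    unfolding S_def sum_distrib_left by (rule sum.swap)
  finally have "norm X \<le> (\<Sum>hs\<in>?L. norm (u hs * S hs))" using norm_sum by simp
  also have "\<dots> \<le> (\<Sum>hs\<in>?L. norm (S hs))"
    by (intro sum_mono) (auto simp: norm_mult intro!: mult_left_le_one_le uv(1))
  finally have "norm X ^ 2 \<le> (\<Sum>hs\<in>?L. 1 * norm (S hs)) ^ 2"
    by (intro power_mono) auto
  also have "\<dots> \<le> (\<Sum>hs\<in>?L. 1 ^ 2) * (\<Sum>hs\<in>?L. norm (S hs) ^ 2)"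
    by (rule Cauchy_Schwarz_ineq_sum)
  also have "(\<Sum>hs\<in>?L. 1 ^ 2) = real N ^ s" by (simp add: cardL)
  \<comment> \<open>Expanding the square gives pairs \<open>h\<close>, \<open>h'\<close>. Congruent
    pairs are bounded trivially and have proportion \<open>1 / p\<close>; for the others the phase
    has coefficient \<open>\<mu> * (h - h')\<close>, nonzero modulo \<open>p\<close>, and induction
    applies.\<close>
  also have "(\<Sum>hs\<in>?L. norm (S hs) ^ 2) \<le> real N ^ (s + 2) * (2 * \<epsilon> + 1 / p)"
  proof -
    define Z where "Z h h' = (\<Sum>hs\<in>?L. Y h hs * cnj (Y h' hs))" for h h'
    have Yn: "norm (Y h hs) \<le> 1" if "length hs = s" for h hs
      using norm_lower_complexity[OF uv(2) that, of h] Suc.prems(2)[of "h + sum_list hs"]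
      by (simp add: Y_def norm_mult mult_le_one)
    have "complex_of_real (\<Sum>hs\<in>?L. norm (S hs) ^ 2) = (\<Sum>hs\<in>?L. S hs * cnj (S hs))"
      by (simp add: complex_norm_square[symmetric])
    also have "\<dots> = (\<Sum>hs\<in>?L. \<Sum>h\<in>?I. \<Sum>h'\<in>?I. Y h hs * cnj (Y h' hs))"
      by (simp add: S_def sum_product)
    also have "\<dots> = (\<Sum>h\<in>?I. \<Sum>hs\<in>?L. \<Sum>h'\<in>?I. Y h hs * cnj (Y h' hs))"
      by (rule sum.swap)
    also have "\<dots> = (\<Sum>h\<in>?I. \<Sum>h'\<in>?I. Z h h')"
      unfolding Z_def by (rule sum.cong[OF refl], rule sum.swap)
    finally have sq: "complex_of_real (\<Sum>hs\<in>?L. norm (S hs) ^ 2) = (\<Sum>h\<in>?I. \<Sum>h'\<in>?I. Z h h')" .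
    have "(\<Sum>hs\<in>?L. norm (S hs) ^ 2) = norm (complex_of_real (\<Sum>hs\<in>?L. norm (S hs) ^ 2))"
      unfolding norm_of_real by (intro abs_of_nonneg[symmetric] sum_nonneg) simp
    also have "\<dots> = norm (\<Sum>h\<in>?I. \<Sum>h'\<in>?I. Z h h')" by (simp only: sq)
    also have "\<dots> \<le> (\<Sum>h\<in>?I. \<Sum>h'\<in>?I. norm (Z h h'))"
      by (intro order_trans[OF norm_sum] sum_mono order_refl)
    also have "\<dots> \<le> (\<Sum>h\<in>?I. \<Sum>h'\<in>?I. 2 * \<epsilon> * real N ^ s + (if int p dvd h - h' then real N ^ s else 0))"
    proof (intro sum_mono)
      fix h h' :: int
      show "norm (Z h h') \<le> 2 * \<epsilon> * real N ^ s + (if int p dvd h - h' then real N ^ s else 0)"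
      proof (cases "int p dvd h - h'")
        case True
        have "norm (Z h h') \<le> (\<Sum>hs\<in>?L. 1)"
          unfolding Z_def using Yn
          by (intro order_trans[OF norm_sum] sum_mono) (auto simp: norm_mult intro!: mult_le_one)
        moreover have "2 * \<epsilon> * real N ^ s \<ge> 0" by (simp add: \<epsilon>_def)
        ultimately show ?thesis using True by (simp add: cardL)
      next
        case False
        have eq: "Y h hs * cnj (Y h' hs) = e_mod p (\<mu> * (h - h') * prod_list hs) *
            (w (h + sum_list hs) * cnj (w (h' + sum_list hs))) * (v h hs * cnj (v h' hs))" for hs
        proof -
          have "e_mod p (\<mu> * (h - h') * prod_list hs) =
              e_mod p (\<mu> * (h * prod_list hs)) * cnj (e_mod p (\<mu> * (h' * prod_list hs)))"
            by (simp add: cnj_e_mod e_mod_add[symmetric] algebra_simps)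
          then show ?thesis by (simp add: Y_def)
        qed
        have "norm (Z h h') \<le> 2 * real p powr (- 1 / 2 ^ s) * real N ^ s"
          unfolding Z_def eq
        proof (rule Suc.IH)
          show "lower_complexity s (\<lambda>hs. v h hs * cnj (v h' hs))"
            by (intro lower_complexity_mult lower_complexity_cnj uv(2))
          show "norm (w (h + x) * cnj (w (h' + x))) \<le> 1" for x
            using Suc.prems(2) by (simp add: norm_mult mult_le_one)
          show "w (h + (x + int Q)) * cnj (w (h' + (x + int Q))) = w (h + x) * cnj (w (h' + x))" for x
            using Suc.prems(3)[of "h + x"] Suc.prems(3)[of "h' + x"] by (simp add: add.assoc)
          show "\<not> int p dvd \<mu> * (h - h')"
            using False Suc.prems(4) p by (simp add: prime_dvd_mult_iff)
        qed
        then show ?thesis using False by (simp add: \<epsilon>_def)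
      qed
    qed
    also have "\<dots> = (\<Sum>h\<in>?I. real N * (2 * \<epsilon> * real N ^ s) + real Q * real N ^ s)"
    proof (rule sum.cong[OF refl])
      fix h
      have "(\<Sum>h'\<in>?I. if int p dvd h - h' then real N ^ s else 0) =
          (\<Sum>h'\<in>{h'\<in>?I. int p dvd h - h'}. real N ^ s)"
        by (rule sum.inter_filter[symmetric]) simp
      also have "\<dots> = real Q * real N ^ s"
        using card_congruent_multiple[OF p0(1), of Q h] N by simp
      finally show "(\<Sum>h'\<in>?I. 2 * \<epsilon> * real N ^ s + (if int p dvd h - h' then real N ^ s else 0))
        = real N * (2 * \<epsilon> * real N ^ s) + real Q * real N ^ s"
        by (simp add: sum.distrib)
    qed
    also have "\<dots> = real N ^ (s + 2) * (2 * \<epsilon> + 1 / p)"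
      using p0 by (simp add: N field_simps power2_eq_square)
    finally show ?thesis .
  qed
  finally have "norm X ^ 2 \<le> real N ^ s * (real N ^ (s + 2) * (2 * \<epsilon> + 1 / p))"
    by (simp add: mult_left_mono)
  also have "\<dots> \<le> real N ^ s * (real N ^ (s + 2) * (4 * \<epsilon>))"
  proof (intro mult_left_mono)
    \<comment> \<open>Since \<open>1 / p \<le> \<epsilon>\<close>, the constant reproduces itself:
      \<open>4 * \<epsilon>\<close> is the square of
      \<open>2 * p powr (- 1 / 2 ^ Suc s)\<close>.\<close>
    have "real p powr (- 1) \<le> \<epsilon>"
      unfolding \<epsilon>_def using p0 by (intro powr_mono) (auto simp: field_simps)
    moreover have "\<epsilon> \<ge> 0" by (simp add: \<epsilon>_def)
    ultimately show "2 * \<epsilon> + 1 / p \<le> 4 * \<epsilon>" using p0 by (simp add: powr_minus_divide)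
  qed auto
  also have "\<dots> = (2 * real p powr (- 1 / 2 ^ Suc s) * real N ^ Suc s) ^ 2"
  proof -
    have "(real p powr (- 1 / 2 ^ Suc s)) ^ 2 = \<epsilon>"
      unfolding \<epsilon>_def using p0 by (simp add: powr_power)
    moreover have "(real N ^ Suc s) ^ 2 = real N ^ s * real N ^ (s + 2)"
      by (simp add: power2_eq_square)
    ultimately show ?thesis by (simp only: power_mult_distrib) simp
  qed
  finally show ?case
    unfolding X_def[symmetric] by (rule power2_le_imp_le) auto
qed

text \<open>\<open>P\<close> is a polynomial of degree at most \<open>s\<close> whose coefficient of degree \<open>s\<close> is \<open>\<mu> / s!\<close>.\<close>

fun polynomial_type :: "nat \<Rightarrow> int \<Rightarrow> (int \<Rightarrow> int) \<Rightarrow> bool" where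
  "polynomial_type 0 \<mu> P \<longleftrightarrow> (\<forall>y. P y = \<mu>)"
| "polynomial_type (Suc s) \<mu> P \<longleftrightarrow> (\<forall>t. polynomial_type s (t * \<mu>) (\<lambda>y. P (y + t) - P y))"

lemma polynomial_type_add:
  "polynomial_type s \<mu> P \<Longrightarrow> polynomial_type s \<nu> R \<Longrightarrow> polynomial_type s (\<mu> + \<nu>) (\<lambda>y. P y + R y)"
proof (induction s arbitrary: \<mu> \<nu> P R)
  case (Suc s)
  have "polynomial_type s (t * \<mu> + t * \<nu>) (\<lambda>y. (P (y + t) - P y) + (R (y + t) - R y))" for t
    by (rule Suc.IH) (use Suc.prems in auto)
  then show ?case by (simp add: algebra_simps)
qed auto

text \<open>Differencing the substituted polynomial by \<open>t\<close> differences \<open>P\<close>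
  by \<open>a * t\<close>, so each of the \<open>s\<close> steps releases one factor
  \<open>a\<close>.\<close>

lemma polynomial_type_affine:
  "polynomial_type s \<mu> P \<Longrightarrow> polynomial_type s (c * a ^ s * \<mu>) (\<lambda>y. c * P (m + a * y))"
proof (induction s arbitrary: \<mu> P)
  case (Suc s)
  have "polynomial_type s (c * a ^ s * (a * t * \<mu>))
      (\<lambda>y. c * (P (m + a * y + a * t) - P (m + a * y)))" for t
    using Suc.IH[of "a * t * \<mu>" "\<lambda>y. P (y + a * t) - P y"] Suc.prems by simp
  then show ?case by (simp add: algebra_simps)
qed auto

lemma polynomial_type_0: "polynomial_type s 0 (\<lambda>y. 0)"
  by (induction s) auto

lemma polynomial_type_sum:
  "finite I \<Longrightarrow> (\<And>i. i \<in> I \<Longrightarrow> polynomial_type s (\<mu> i) (P i)) \<Longrightarrow>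
    polynomial_type s (\<Sum>i\<in>I. \<mu> i) (\<lambda>y. \<Sum>i\<in>I. P i y)"
  by (induction I rule: finite_induct) (auto simp: polynomial_type_0 intro: polynomial_type_add)

text \<open>The binomial theorem expresses a difference of \<open>y ^ j\<close> through lower
  powers. Only \<open>i = s\<close> reaches the top degree, and then \<open>j = Suc s\<close> with
  binomial coefficient \<open>Suc s\<close>, which builds up the factorial.\<close>

lemma polynomial_type_power:
  "j \<le> s \<Longrightarrow> polynomial_type s (if j = s then fact s else 0) (\<lambda>y. y ^ j)"
proof (induction s arbitrary: j)
  case (Suc s)
  show ?case unfolding polynomial_type.simps
  proof
    fix t :: int
    let ?\<mu> = "\<lambda>i. if i = s then fact s else 0 :: int"
    have eq: "(\<lambda>y. (y + t) ^ j - y ^ j) = (\<lambda>y. \<Sum>i<j. (of_nat (j choose i) * t ^ (j - i)) * y ^ i)"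
    proof
      fix y :: int
      have "(y + t) ^ j = (\<Sum>i\<le>j. of_nat (j choose i) * y ^ i * t ^ (j - i))"
        by (rule binomial_ring)
      also have "\<dots> = (\<Sum>i<j. of_nat (j choose i) * y ^ i * t ^ (j - i)) + y ^ j"
        by (simp add: lessThan_Suc_atMost[symmetric])
      finally show "(y + t) ^ j - y ^ j = (\<Sum>i<j. (of_nat (j choose i) * t ^ (j - i)) * y ^ i)"
        by (simp add: mult_ac)
    qed
    have "polynomial_type s (\<Sum>i<j. (of_nat (j choose i) * t ^ (j - i)) * 1 ^ s * ?\<mu> i)
        (\<lambda>y. \<Sum>i<j. (of_nat (j choose i) * t ^ (j - i)) * y ^ i)"
    proof (rule polynomial_type_sum)
      fix i assume "i \<in> {..<j}"
      then have "polynomial_type s (?\<mu> i) (\<lambda>y. y ^ i)" using Suc by auto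
      from polynomial_type_affine[OF this, of "of_nat (j choose i) * t ^ (j - i)" 1 0]
      show "polynomial_type s ((of_nat (j choose i) * t ^ (j - i)) * 1 ^ s * ?\<mu> i)
        (\<lambda>y. (of_nat (j choose i) * t ^ (j - i)) * y ^ i)" by simp
    qed simp
    also have "(\<Sum>i<j. (of_nat (j choose i) * t ^ (j - i)) * 1 ^ s * ?\<mu> i) = t * (if j = Suc s then fact (Suc s) else 0)"
    proof (cases "j = Suc s")
      case True
      then show ?thesis by (simp add: if_distrib[of "\<lambda>x. _ * x"] sum.delta cong: if_cong)
    next
      case False
      then show ?thesis using Suc.prems by (auto intro!: sum.neutral)
    qed
    finally show "polynomial_type s (t * (if j = Suc s then fact (Suc s) else 0)) (\<lambda>y. (y + t) ^ j - y ^ j)"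
      unfolding eq .
  qed
qed auto

text \<open>Split \<open>P (y + t)\<close> as \<open>P y\<close> plus a difference. The first term
  does not involve \<open>t\<close>; the second has degree one less and falls to induction. Only the
  multilinear top term stays outside the factor of lower complexity.\<close>

lemma e_mod_polynomial_phase:
  assumes "polynomial_type s \<mu> P"
  shows "\<exists>b. lower_complexity s b \<and>
    (\<forall>hs. length hs = s \<longrightarrow> e_mod p (P (sum_list hs)) = b hs * e_mod p (\<mu> * prod_list hs))"
  using assms
proof (induction s arbitrary: \<mu> P)
  case 0
  then show ?case by (intro exI[of _ "\<lambda>_. 1"]) auto
next
  case (Suc s)
  have "\<forall>t. \<exists>b. lower_complexity s b \<and> (\<forall>hs. length hs = s \<longrightarrow>
      e_mod p (P (sum_list hs + t) - P (sum_list hs)) = b hs * e_mod p (t * \<mu> * prod_list hs))"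
  proof
    fix t
    show "\<exists>b. lower_complexity s b \<and> (\<forall>hs. length hs = s \<longrightarrow>
      e_mod p (P (sum_list hs + t) - P (sum_list hs)) = b hs * e_mod p (t * \<mu> * prod_list hs))"
      using Suc.IH[of "t * \<mu>" "\<lambda>y. P (y + t) - P y"] Suc.prems by simp
  qed
  then obtain v where v: "\<And>t. lower_complexity s (v t)"
    "\<And>t hs. length hs = s \<Longrightarrow> e_mod p (P (sum_list hs + t) - P (sum_list hs)) = v t hs * e_mod p (t * \<mu> * prod_list hs)"
    by metis
  define b where "b hs = e_mod p (P (sum_list (tl hs))) * v (hd hs) (tl hs)" for hs
  have "lower_complexity (Suc s) b"
    unfolding lower_complexity.simps b_def
    by (intro exI[of _ "\<lambda>hs. e_mod p (P (sum_list hs))"] exI[of _ v]) (auto simp: v(1))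
  moreover have "e_mod p (P (sum_list hs)) = b hs * e_mod p (\<mu> * prod_list hs)" if "length hs = Suc s" for hs
  proof -
    obtain t ts where hs: "hs = t # ts" "length ts = s" using \<open>length hs = Suc s\<close> by (cases hs) auto
    have "P (sum_list hs) = P (sum_list ts) + (P (sum_list ts + t) - P (sum_list ts))"
      by (simp add: hs add.commute)
    then have "e_mod p (P (sum_list hs)) = e_mod p (P (sum_list ts)) * e_mod p (P (sum_list ts + t) - P (sum_list ts))"
      by (metis e_mod_add)
    then show ?thesis using v(2)[OF hs(2), of t] by (simp add: b_def hs mult_ac)
  qed
  ultimately show ?case by blast
qed

text \<open>The multilinear coefficient of \<open>\<xi> * (n - y) ^ s\<close> carries
  \<open>fact s\<close>, which is why \<open>p > s\<close> is assumed later.\<close>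

lemma e_mod_power_phase:
  "\<exists>b. lower_complexity s b \<and> (\<forall>hs. length hs = s \<longrightarrow>
    e_mod p (\<xi> * (n - sum_list hs) ^ s) = b hs * e_mod p (\<xi> * (- 1) ^ s * fact s * prod_list hs))"
  using e_mod_polynomial_phase[OF polynomial_type_affine[OF polynomial_type_power[of s s, OF order_refl], of \<xi> "- 1" n], of p]
  by (simp add: mult.assoc)

subsection \<open>Uniformity of sets defined by a polynomial phase\<close>

text \<open>The derivative \<open>mult_deriv\<close> transported to the integers, where powers and
  shifts need no reduction modulo \<open>N\<close>.\<close>

definition int_deriv :: "int \<Rightarrow> (int \<Rightarrow> complex) \<Rightarrow> int \<Rightarrow> complex" where
  "int_deriv h f = (\<lambda>n. f n * cnj (f (n - h)))"

lemma foldr_int_deriv_Cons: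
  "foldr int_deriv (h # hs) f n = foldr int_deriv hs f n * cnj (foldr int_deriv hs f (n - h))"
  by (simp add: int_deriv_def)

lemma foldr_mult_deriv_eq:
  assumes "N > 0" "set hs \<subseteq> {0..<int N}" "n \<in> {0..<int N}"
  shows "foldr (mult_deriv (integer_mod_group N)) hs f n = foldr int_deriv hs (\<lambda>x. f (x mod int N)) n"
  using assms(2,3)
proof (induction hs arbitrary: n)
  case (Cons h hs)
  \<comment> \<open>Reducing modulo \<open>N\<close> at every stage is harmless, since iterated
    derivatives of an \<open>N\<close>-periodic function are \<open>N\<close>-periodic.\<close>
  have per: "foldr int_deriv hs (\<lambda>x. f (x mod int N)) (x mod int N) =
      foldr int_deriv hs (\<lambda>x. f (x mod int N)) x" for x
  proof (induction hs arbitrary: x)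
    case (Cons h hs)
    have *: "foldr int_deriv hs (\<lambda>x. f (x mod int N)) (x mod int N - h) =
        foldr int_deriv hs (\<lambda>x. f (x mod int N)) (x - h)"
      using Cons[of "x - h"] Cons[of "x mod int N - h"] by (simp add: mod_diff_left_eq)
    show ?case by (simp only: foldr_int_deriv_Cons Cons[of x] *)
  qed simp
  have h: "h \<in> carrier (integer_mod_group N)"
    using Cons.prems assms(1) by (simp add: carrier_integer_mod_group)
  have "(n + (- h) mod int N) mod int N \<in> {0..<int N}" using assms(1) by simp
  then have "foldr (mult_deriv (integer_mod_group N)) hs f ((n + (- h) mod int N) mod int N)
      = foldr int_deriv hs (\<lambda>x. f (x mod int N)) ((n - h) mod int N)"
    using Cons.IH[of "(n + (- h) mod int N) mod int N"] Cons.prems by (simp add: mod_simps)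
  also have "\<dots> = foldr int_deriv hs (\<lambda>x. f (x mod int N)) (n - h)" by (rule per)
  finally have B: "foldr (mult_deriv (integer_mod_group N)) hs f ((n + (- h) mod int N) mod int N)
      = foldr int_deriv hs (\<lambda>x. f (x mod int N)) (n - h)" .
  have "foldr (mult_deriv (integer_mod_group N)) (h # hs) f n =
      foldr (mult_deriv (integer_mod_group N)) hs f n *
      cnj (foldr (mult_deriv (integer_mod_group N)) hs f ((n + (- h) mod int N) mod int N))"
    using h by (simp add: mult_deriv_def)
  moreover have "foldr (mult_deriv (integer_mod_group N)) hs f n = foldr int_deriv hs (\<lambda>x. f (x mod int N)) n"
    using Cons by simp
  ultimately show ?case by (simp only: B foldr_int_deriv_Cons)
qed simp

lemma norm_foldr_int_deriv:
  assumes "\<And>x. norm (f x) \<le> 1"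
  shows "norm (foldr int_deriv hs f n) \<le> 1"
  by (induction hs arbitrary: n) (auto simp: assms foldr_int_deriv_Cons norm_mult simp del: foldr_Cons intro!: mult_le_one)

lemma foldr_int_deriv_eq:
  assumes "\<And>x. norm (f x) \<le> 1" "\<And>x. cnj (f x) = f x"
  shows "\<exists>b. lower_complexity s b \<and>
    (\<forall>hs. length hs = s \<longrightarrow> foldr int_deriv hs f n = b hs * f (n - sum_list hs))"
proof (induction s arbitrary: n)
  case 0
  then show ?case by (intro exI[of _ "\<lambda>_. 1"]) auto
next
  case (Suc s)
  then obtain B where B: "\<And>n. lower_complexity s (B n)"
    "\<And>n hs. length hs = s \<Longrightarrow> foldr int_deriv hs f n = B n hs * f (n - sum_list hs)"
    by metis
  define b where "b hs = foldr int_deriv (tl hs) f n * cnj (B (n - hd hs) (tl hs))" for hs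
  have "lower_complexity (Suc s) b"
    unfolding lower_complexity.simps b_def
    by (intro exI[of _ "\<lambda>hs. foldr int_deriv hs f n"] exI[of _ "\<lambda>h hs. cnj (B (n - h) hs)"])
      (auto simp: B(1) intro!: lower_complexity_cnj norm_foldr_int_deriv assms(1))
  moreover have "foldr int_deriv hs f n = b hs * f (n - sum_list hs)" if "length hs = Suc s" for hs
  proof -
    obtain t ts where hs: "hs = t # ts" "length ts = s" using \<open>length hs = Suc s\<close> by (cases hs) auto
    have "foldr int_deriv hs f n = foldr int_deriv ts f n * cnj (foldr int_deriv ts f (n - t))"
      by (simp add: hs foldr_int_deriv_Cons del: foldr_Cons)
    also have "foldr int_deriv ts f (n - t) = B (n - t) ts * f (n - t - sum_list ts)"
      by (rule B(2)[OF hs(2)])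
    finally show ?thesis by (simp add: b_def hs assms(2) algebra_simps)
  qed
  ultimately show ?case by blast
qed

section \<open>Fourier analysis of an interval modulo \<open>p\<close>\<close>

lemma interval_Fourier_expansion:
  fixes l z :: int
  assumes "p > 0" "0 \<le> l" "l + int m \<le> int p"
  shows "(\<Sum>\<xi><p. ((\<Sum>t<m. e_mod p (- int \<xi> * (l + int t))) / of_nat p) * e_mod p (int \<xi> * z))
    = (if z mod int p \<in> {l..<l + int m} then 1 else 0)"
proof -
  have "(\<Sum>\<xi><p. ((\<Sum>t<m. e_mod p (- int \<xi> * (l + int t))) / of_nat p) * e_mod p (int \<xi> * z))
      = (\<Sum>\<xi><p. \<Sum>t<m. e_mod p (int \<xi> * (z - (l + int t))) / of_nat p)"
  proof (rule sum.cong[OF refl])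
    fix \<xi>
    have "e_mod p (int \<xi> * (z - (l + int t))) = e_mod p (- int \<xi> * (l + int t)) * e_mod p (int \<xi> * z)" for t
      unfolding e_mod_add[symmetric] by (simp add: algebra_simps)
    then show "((\<Sum>t<m. e_mod p (- int \<xi> * (l + int t))) / of_nat p) * e_mod p (int \<xi> * z)
        = (\<Sum>t<m. e_mod p (int \<xi> * (z - (l + int t))) / of_nat p)"
      by (simp add: sum_distrib_right sum_divide_distrib)
  qed
  also have "\<dots> = (\<Sum>t<m. (\<Sum>\<xi><p. e_mod p (int \<xi> * (z - (l + int t)))) / of_nat p)"
    unfolding sum_divide_distrib by (rule sum.swap)
  also have "\<dots> = (\<Sum>t<m. if z mod int p = l + int t then 1 else 0)"
  proof (rule sum.cong[OF refl])
    fix t assume "t \<in> {..<m}"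
    then have "(l + int t) mod int p = l + int t" using assms by (intro mod_pos_pos_trivial) auto
    then have "int p dvd z - (l + int t) \<longleftrightarrow> z mod int p = l + int t"
      by (metis mod_eq_dvd_iff)
    then show "(\<Sum>\<xi><p. e_mod p (int \<xi> * (z - (l + int t)))) / of_nat p = (if z mod int p = l + int t then 1 else 0)"
      using assms(1) by (simp add: sum_e_mod)
  qed
  also have "\<dots> = (if z mod int p \<in> {l..<l + int m} then 1 else 0)"
  proof (cases "z mod int p \<in> {l..<l + int m}")
    case True
    then have "(\<Sum>t<m. if z mod int p = l + int t then 1 else 0 :: complex) = (\<Sum>t<m. if t = nat (z mod int p - l) then 1 else 0)"
      by (intro sum.cong) auto
    also have "\<dots> = 1" using True by (subst sum.delta) auto
    finally show ?thesis using True by simp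
  next
    case False
    then show ?thesis by (auto intro!: sum.neutral)
  qed
  finally show ?thesis .
qed

lemma harm_le_ln: "n > 0 \<Longrightarrow> harm n \<le> 1 + ln (real n)"
proof -
  assume "n > 0"
  then obtain m where m: "n = Suc m" using gr0_implies_Suc by blast
  have "harm (Suc m) - ln (real (Suc m)) \<le> harm (Suc 0) - ln (real (Suc 0))"
    using decseqD[OF decseq_harm_diff_ln, of 0 m] by simp
  then show ?thesis by (simp add: m harm_expand(1) harm_Suc)
qed

text \<open>The nonzero Fourier coefficients of any interval have absolute sum
  \<open>O(ln p)\<close>, which a power saving in \<open>p\<close> outweighs.\<close>

lemma interval_Fourier_l1:
  assumes "p > 1"
  shows "(\<Sum>\<xi>\<in>{1..<p}. 1 / (real p * sin (pi * real \<xi> / real p))) \<le> 2 * (1 + ln (real p))"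
proof -
  have "(\<Sum>\<xi>\<in>{1..<p}. 1 / (real p * sin (pi * real \<xi> / real p))) \<le> (\<Sum>\<xi>\<in>{1..<p}. 1 / real \<xi> + 1 / (real p - real \<xi>))"
    by (intro sum_mono sin_pi_fraction_ge) auto
  also have "\<dots> = (\<Sum>\<xi>\<in>{1..<p}. 1 / real \<xi>) + (\<Sum>\<xi>\<in>{1..<p}. 1 / (real p - real \<xi>))"
    by (rule sum.distrib)
  also have "(\<Sum>\<xi>\<in>{1..<p}. 1 / (real p - real \<xi>)) = (\<Sum>\<xi>\<in>{1..<p}. 1 / real \<xi>)"
    by (rule sum.reindex_bij_witness[of _ "\<lambda>i. p - i" "\<lambda>i. p - i"]) auto
  also have "(\<Sum>\<xi>\<in>{1..<p}. 1 / real \<xi>) = harm (p - 1)"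
    unfolding harm_def using assms by (intro sum.cong) (auto simp: field_simps)
  also have "harm (p - 1) \<le> 1 + ln (real (p - 1))" using assms by (intro harm_le_ln) auto
  also have "\<dots> \<le> 1 + ln (real p)" using assms by simp
  finally show ?thesis by simp
qed

text \<open>Expand the indicator of the interval in a Fourier series. The zero frequency agrees with
  \<open>\<alpha>\<close> up to \<open>1 / p\<close>; every other frequency is a phase of degree
  \<open>s\<close> times a \<open>Q\<close>-periodic coefficient, to which
  \<open>multilinear_exponential_sum_bound\<close> applies. Summing over frequencies costs a
  logarithm.\<close>

lemma polynomial_interval_correlation:
  assumes p: "prime p" "p > s" and Q: "coprime p Q" "Q > 0" and N: "N = Q * p" and s: "s \<ge> 1"
    and b: "lower_complexity s b"
    and l: "\<And>x. 0 \<le> l x" "\<And>x. l x + int (m x) \<le> int p" "\<And>x. \<bar>real (m x) / real p - \<alpha>\<bar> \<le> 1 / real p"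
    and per: "\<And>x. l (x + int Q) = l x" "\<And>x. m (x + int Q) = m x"
  defines "f \<equiv> \<lambda>x. (if x ^ s mod int p \<in> {l x..<l x + int (m x)} then 1 else 0) - complex_of_real \<alpha>"
  shows "norm (\<Sum>hs\<in>{hs. set hs \<subseteq> {0..<int N} \<and> length hs = s}. b hs * f (n - sum_list hs))
    \<le> (1 / real p + 4 * (1 + ln (real p)) * real p powr (- 1 / 2 ^ s)) * real N ^ s"
proof -
  let ?L = "{hs. set hs \<subseteq> {0..<int N} \<and> length hs = s}"
  define c where "c x \<xi> = (\<Sum>t<m x. e_mod p (- int \<xi> * (l x + int t))) / of_nat p" for x and \<xi> :: nat
  \<comment> \<open>\<open>\<kappa> \<xi>\<close> majorizes the coefficient \<open>c x \<xi>\<close>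
    for every \<open>x\<close>; dividing by it yields a weight bounded by 1.\<close>
  define \<kappa> where "\<kappa> \<xi> = 1 / (real p * sin (pi * real \<xi> / real p))" for \<xi> :: nat
  define F where "F \<xi> = (\<Sum>hs\<in>?L. b hs * (c (n - sum_list hs) \<xi> * e_mod p (int \<xi> * (n - sum_list hs) ^ s)))" for \<xi>
  have p0: "p > 0" "p > 1" using p prime_gt_0_nat prime_gt_1_nat by blast+
  have finL: "finite ?L" and cardL: "card ?L = N ^ s"
    using finite_lists_length_eq[of "{0..<int N}" s] card_lists_length_eq[of "{0..<int N}" s] by auto
  have feq: "f x = (c x 0 - of_real \<alpha>) + (\<Sum>\<xi>\<in>{1..<p}. c x \<xi> * e_mod p (int \<xi> * x ^ s))" for x
  proof -
    have "{..<p} = insert 0 {1..<p}" using p0 by auto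
    then have "(\<Sum>\<xi><p. c x \<xi> * e_mod p (int \<xi> * x ^ s)) = c x 0 + (\<Sum>\<xi>\<in>{1..<p}. c x \<xi> * e_mod p (int \<xi> * x ^ s))"
      by simp
    moreover have "(\<Sum>\<xi><p. c x \<xi> * e_mod p (int \<xi> * x ^ s)) = f x + of_real \<alpha>"
      unfolding c_def using interval_Fourier_expansion[OF p0(1) l(1,2), of x "x ^ s"] by (simp add: f_def)
    ultimately show ?thesis by (simp add: algebra_simps)
  qed
  have c0: "norm (c x 0 - of_real \<alpha>) \<le> 1 / p" for x
  proof -
    have "c x 0 - of_real \<alpha> = of_real (real (m x) / real p - \<alpha>)" by (simp add: c_def)
    then show ?thesis using l(3)[of x] by (metis norm_of_real)
  qed
  have bn: "norm (b hs) \<le> 1" if "hs \<in> ?L" for hs using norm_lower_complexity[OF b] that by simp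
  have Fb: "norm (F \<xi>) \<le> \<kappa> \<xi> * (2 * real p powr (- 1 / 2 ^ s) * real N ^ s)" if "\<xi> \<in> {1..<p}" for \<xi>
  proof -
    have \<xi>: "0 < \<xi>" "\<xi> < p" using that by auto
    have "sin (pi * real \<xi> / real p) > 0"
      using \<xi> by (intro sin_gt_zero) (auto simp: field_simps)
    then have \<kappa>0: "\<kappa> \<xi> > 0" using p0 by (simp add: \<kappa>_def)
    obtain b' where b': "lower_complexity s b'" "\<And>hs. length hs = s \<Longrightarrow>
      e_mod p (int \<xi> * (n - sum_list hs) ^ s) = b' hs * e_mod p (int \<xi> * (- 1) ^ s * fact s * prod_list hs)"
      using e_mod_power_phase by blast
    define w where "w y = c (n - y) \<xi> / of_real (\<kappa> \<xi>)" for y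
    have "F \<xi> = of_real (\<kappa> \<xi>) * (\<Sum>hs\<in>?L.
        e_mod p (int \<xi> * (- 1) ^ s * fact s * prod_list hs) * w (sum_list hs) * (b hs * b' hs))"
      unfolding F_def sum_distrib_left using \<kappa>0 by (intro sum.cong refl) (simp add: b'(2) w_def)
    also have "norm \<dots> = \<kappa> \<xi> * norm (\<Sum>hs\<in>?L.
        e_mod p (int \<xi> * (- 1) ^ s * fact s * prod_list hs) * w (sum_list hs) * (b hs * b' hs))"
      using \<kappa>0 by (simp add: norm_mult)
    also have "\<dots> \<le> \<kappa> \<xi> * (2 * real p powr (- 1 / 2 ^ s) * real N ^ s)"
    proof (intro mult_left_mono multilinear_exponential_sum_bound[OF p(1) Q N s])
      show "lower_complexity s (\<lambda>hs. b hs * b' hs)" using b b'(1) by (rule lower_complexity_mult)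
      show "norm (w x) \<le> 1" for x
      proof -
        let ?X = "\<Sum>t<m (n - x). e_mod p (- int \<xi> * (l (n - x) + int t))"
        have "norm (w x) = norm ?X / real p / \<kappa> \<xi>"
          unfolding w_def c_def norm_divide using \<kappa>0 by simp
        also have "\<dots> = norm ?X * sin (pi * real \<xi> / real p)" using p0 by (simp add: \<kappa>_def)
        also have "\<dots> \<le> 1 / sin (pi * real \<xi> / real p) * sin (pi * real \<xi> / real p)"
          using \<open>sin (pi * real \<xi> / real p) > 0\<close> norm_sum_e_mod_interval[OF \<xi>]
          by (intro mult_right_mono) auto
        finally show ?thesis using \<open>sin (pi * real \<xi> / real p) > 0\<close> by simp
      qed
      show "w (x + int Q) = w x" for x
        using per(1)[of "n - x - int Q"] per(2)[of "n - x - int Q"]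
        by (simp add: w_def c_def algebra_simps)
      \<comment> \<open>Here \<open>p > s\<close> enters: \<open>fact s\<close> is invertible modulo
        \<open>p\<close>.\<close>
      have "\<not> p dvd fact s" using p by (simp add: prime_dvd_fact_iff)
      then have "\<not> int p dvd fact s" by (metis int_dvd_int_iff of_nat_fact)
      moreover have "\<not> int p dvd int \<xi>" using \<xi> by (auto dest: dvd_imp_le)
      ultimately show "\<not> int p dvd int \<xi> * (- 1) ^ s * fact s"
        using p(1) by (auto simp: prime_dvd_mult_iff minus_one_power_iff)
    qed (use \<kappa>0 in auto)
    finally show ?thesis .
  qed
  have "(\<Sum>hs\<in>?L. b hs * f (n - sum_list hs)) =
      (\<Sum>hs\<in>?L. b hs * (c (n - sum_list hs) 0 - of_real \<alpha>)) + (\<Sum>\<xi>\<in>{1..<p}. F \<xi>)"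
    unfolding F_def feq by (simp only: distrib_left sum.distrib sum_distrib_left, subst sum.swap, rule refl)
  also have "norm \<dots> \<le> (\<Sum>hs\<in>?L. 1 / real p) + (\<Sum>\<xi>\<in>{1..<p}. \<kappa> \<xi> * (2 * real p powr (- 1 / 2 ^ s) * real N ^ s))"
  proof (intro order_trans[OF norm_triangle_ineq] add_mono order_trans[OF norm_sum] sum_mono Fb)
    fix hs assume "hs \<in> ?L"
    from mult_mono[OF bn[OF this] c0, of "n - sum_list hs"]
    show "norm (b hs * (c (n - sum_list hs) 0 - of_real \<alpha>)) \<le> 1 / real p" by (simp add: norm_mult)
  qed
  also have "(\<Sum>\<xi>\<in>{1..<p}. \<kappa> \<xi> * (2 * real p powr (- 1 / 2 ^ s) * real N ^ s))
      = (\<Sum>\<xi>\<in>{1..<p}. \<kappa> \<xi>) * (2 * real p powr (- 1 / 2 ^ s) * real N ^ s)"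
    by (rule sum_distrib_right[symmetric])
  also have "\<dots> \<le> 2 * (1 + ln (real p)) * (2 * real p powr (- 1 / 2 ^ s) * real N ^ s)"
    unfolding \<kappa>_def by (intro mult_right_mono interval_Fourier_l1 p0) auto
  finally show ?thesis using cardL by (simp add: algebra_simps)
qed

text \<open>For each base point \<open>n\<close> the iterated derivative is a factor of lower
  complexity times one copy of \<open>f\<close>, so the correlation bound applies to every inner
  sum.\<close>

lemma gowers_norm_polynomial_interval:
  assumes p: "prime p" "p > s" and Q: "coprime p Q" "Q > 0" and N: "N = Q * p" and s: "s \<ge> 1"
    and \<alpha>: "0 \<le> \<alpha>" "\<alpha> \<le> 1"
    and l: "\<And>x. 0 \<le> l x" "\<And>x. l x + int (m x) \<le> int p" "\<And>x. \<bar>real (m x) / real p - \<alpha>\<bar> \<le> 1 / real p"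
    and per: "\<And>x. l (x + int Q) = l x" "\<And>x. m (x + int Q) = m x"
    and A: "A = {x \<in> {0..<int N}. x ^ s mod int p \<in> {l x..<l x + int (m x)}}"
  shows "gowers_norm (integer_mod_group N) s (\<lambda>x. indicator A x - complex_of_real \<alpha>)
    \<le> root (2 ^ s) (1 / real p + 4 * (1 + ln (real p)) * real p powr (- 1 / 2 ^ s))"
proof -
  let ?L = "{hs. set hs \<subseteq> {0..<int N} \<and> length hs = s}"
  let ?B = "1 / real p + 4 * (1 + ln (real p)) * real p powr (- 1 / 2 ^ s)"
  define f where "f x = (if x ^ s mod int p \<in> {l x..<l x + int (m x)} then 1 else 0) - complex_of_real \<alpha>" for x
  have p0: "p > 0" using p prime_gt_0_nat by blast
  have N0: "N > 0" using N Q p0 by simp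
  \<comment> \<open>Both \<open>Q\<close> and \<open>p\<close> divide \<open>N\<close>, so the
    condition defining \<open>A\<close> extends to an \<open>N\<close>-periodic one on the
    integers.\<close>
  have "indicator A (x mod int N) - complex_of_real \<alpha> = f x" for x
  proof -
    have "x = x mod int N + int Q * (int p * (x div int N))"
      using mod_mult_div_eq[of x "int N"] by (simp add: N mult.assoc)
    then have "l x = l (x mod int N)" "m x = m (x mod int N)"
      by (metis periodic_mult per(1), metis periodic_mult per(2))
    moreover have "(x mod int N) ^ s mod int p = x ^ s mod int p"
      by (metis N dvd_triv_right mod_mod_cancel of_nat_mult power_mod)
    ultimately show ?thesis using N0 by (auto simp: f_def A indicator_def)
  qed
  then have feq: "(\<lambda>x. indicator A (x mod int N) - complex_of_real \<alpha>) = f" by auto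
  have fn: "norm (f x) \<le> 1" and fc: "cnj (f x) = f x" for x
  proof -
    have "f x = of_real ((if x ^ s mod int p \<in> {l x..<l x + int (m x)} then 1 else 0) - \<alpha>)"
      by (simp add: f_def)
    then have "norm (f x) = \<bar>(if x ^ s mod int p \<in> {l x..<l x + int (m x)} then 1 else 0) - \<alpha>\<bar>"
      by (metis norm_of_real)
    then show "norm (f x) \<le> 1" using \<alpha> by auto
    show "cnj (f x) = f x" by (simp add: f_def)
  qed
  define S where "S = (\<Sum>n\<in>{0..<int N}. \<Sum>hs\<in>?L. foldr (mult_deriv (integer_mod_group N)) hs
      (\<lambda>x. indicator A x - complex_of_real \<alpha>) n)"
  have "S = (\<Sum>n\<in>{0..<int N}. \<Sum>hs\<in>?L. foldr int_deriv hs f n)"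
    unfolding S_def by (intro sum.cong refl) (simp add: foldr_mult_deriv_eq[OF N0] feq)
  also have "norm \<dots> \<le> (\<Sum>n\<in>{0..<int N}. ?B * real N ^ s)"
  proof (rule order_trans[OF norm_sum], rule sum_mono)
    fix n
    obtain b where b: "lower_complexity s b"
      "\<And>hs. length hs = s \<Longrightarrow> foldr int_deriv hs f n = b hs * f (n - sum_list hs)"
      using foldr_int_deriv_eq[of f s n] fn fc by blast
    have "(\<Sum>hs\<in>?L. foldr int_deriv hs f n) = (\<Sum>hs\<in>?L. b hs * f (n - sum_list hs))"
      by (intro sum.cong refl) (simp add: b(2))
    then show "norm (\<Sum>hs\<in>?L. foldr int_deriv hs f n) \<le> ?B * real N ^ s"
      using polynomial_interval_correlation[where l = l and m = m and \<alpha> = \<alpha> and n = n, OF p Q N s b(1)] l per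
      by (simp add: f_def)
  qed
  finally have "norm S \<le> ?B * real N ^ (s + 1)" by (simp add: mult_ac)
  then have "norm S / real N ^ (s + 1) \<le> ?B" using N0 by (simp add: field_simps)
  moreover have "Re (S / of_nat N ^ (s + 1)) \<le> norm S / real N ^ (s + 1)"
    using complex_Re_le_cmod[of "S / of_nat N ^ (s + 1)"] by (simp add: norm_divide norm_mult norm_power)
  ultimately have "Re (S / of_nat N ^ (s + 1)) \<le> ?B" by linarith
  then show ?thesis
    unfolding gowers_norm_def using N0
    by (simp add: carrier_integer_mod_group S_def)
qed

subsection \<open>The linear relation among polynomial values\<close>

text \<open>Lagrange interpolation; the coefficient of degree \<open>k - 1\<close> is the divided
  difference of the data.\<close>

lemma interpolation_exists:
  fixes x y :: "nat \<Rightarrow> real"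
  assumes inj: "inj_on x {..<k}" and k: "k > 0"
  shows "\<exists>L. (\<forall>i<k. poly L (x i) = y i) \<and> degree L < k \<and>
    coeff L (k - 1) = (\<Sum>i<k. y i / (\<Prod>j\<in>{..<k} - {i}. x i - x j))"
proof -
  define w where "w i = (\<Prod>j\<in>{..<k} - {i}. x i - x j)" for i
  define l where "l i = (\<Prod>j\<in>{..<k} - {i}. [:- x j, 1:])" for i
  define L where "L = (\<Sum>i<k. smult (y i / w i) (l i))"
  have w0: "w i \<noteq> 0" if "i < k" for i
    using inj that by (auto simp: w_def inj_on_def)
  have dl: "degree (l i) = k - 1" if "i < k" for i
    using that unfolding l_def by (subst degree_prod_sum_eq) auto
  have cl: "coeff (l i) (k - 1) = 1" if "i < k" for i
    unfolding dl[OF that, symmetric] unfolding l_def lead_coeff_prod by simp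
  have "poly L (x m) = y m" if "m < k" for m
  proof -
    have "poly (l i) (x m) = (if i = m then w m else 0)" if "i < k" for i
      using \<open>m < k\<close> that by (auto simp: l_def w_def poly_prod)
    then have "poly L (x m) = (\<Sum>i<k. if i = m then y m / w m * w m else 0)"
      unfolding L_def poly_sum by (intro sum.cong refl) auto
    then show ?thesis using that w0 by simp
  qed
  moreover have "degree L < k"
    unfolding L_def by (intro degree_sum_less) (auto intro: le_less_trans[OF degree_smult_le] simp: dl k)
  moreover have "coeff L (k - 1) = (\<Sum>i<k. y i / w i)"
    unfolding L_def coeff_sum by (intro sum.cong refl) (simp add: cl del: One_nat_def)
  ultimately show ?thesis unfolding w_def by blast
qed

text \<open>A polynomial of degree below \<open>k - 1\<close> is its own interpolant, so its
  coefficient of degree \<open>k - 1\<close> is zero.\<close>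

lemma divided_difference_vanishes:
  fixes x :: "nat \<Rightarrow> real"
  assumes inj: "inj_on x {..<k}" and h: "degree h + 1 < k"
  shows "(\<Sum>i<k. poly h (x i) / (\<Prod>j\<in>{..<k} - {i}. x i - x j)) = 0"
proof -
  obtain L where L: "\<forall>i<k. poly L (x i) = poly h (x i)" "degree L < k"
    "coeff L (k - 1) = (\<Sum>i<k. poly h (x i) / (\<Prod>j\<in>{..<k} - {i}. x i - x j))"
    using interpolation_exists[OF inj, of "\<lambda>i. poly h (x i)"] h by auto
  have "L = h"
    using L inj h by (intro poly_eqI_degree[of "x ` {..<k}"]) (auto simp: card_image)
  then show ?thesis using L(3) h by (simp add: coeff_eq_0)
qed

text \<open>By Rolle, a polynomial interpolating a step function has a derivative with \<open>k - 2\<close> zeros,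
  hence full degree \<open>k - 1\<close>.\<close>

lemma divided_difference_step_nonzero:
  fixes x :: "nat \<Rightarrow> real"
  assumes x: "\<And>i j. i < j \<Longrightarrow> j < k \<Longrightarrow> x i < x j" and m: "0 < m" "m < k" and k: "k \<ge> 3"
  shows "(\<Sum>i\<in>{m..<k}. 1 / (\<Prod>j\<in>{..<k} - {i}. x i - x j)) \<noteq> 0"
proof
  assume zero: "(\<Sum>i\<in>{m..<k}. 1 / (\<Prod>j\<in>{..<k} - {i}. x i - x j)) = 0"
  have inj: "inj_on x {..<k}"
    by (intro inj_onI) (metis lessThan_iff less_irrefl linorder_neqE_nat x)
  define y where "y i = (if i < m then 0 else 1 :: real)" for i :: nat
  obtain L where L: "\<And>i. i < k \<Longrightarrow> poly L (x i) = y i" "degree L < k"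
    "coeff L (k - 1) = (\<Sum>i<k. y i / (\<Prod>j\<in>{..<k} - {i}. x i - x j))"
    using interpolation_exists[OF inj, of y] k by auto
  have "(\<Sum>i<k. y i / (\<Prod>j\<in>{..<k} - {i}. x i - x j)) = (\<Sum>i\<in>{m..<k}. 1 / (\<Prod>j\<in>{..<k} - {i}. x i - x j))"
    using m by (intro sum.mono_neutral_cong_right) (auto simp: y_def)
  with L(3) zero have "coeff L (k - 1) = 0" by simp
  have dL: "degree L \<le> k - 2"
  proof (rule ccontr)
    assume "\<not> degree L \<le> k - 2"
    then have d: "degree L = k - 1" using L(2) by simp
    then have "L = 0" using \<open>coeff L (k - 1) = 0\<close> by (metis leading_coeff_0_iff)
    then show False using d k by simp
  qed
  \<comment> \<open>The gaps between consecutive nodes, except the one containing the jump. On each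
    of these \<open>k - 2\<close> gaps \<open>L\<close> has equal end values.\<close>
  define I where "I = {..<k - 1} - {m - 1}"
  have "\<exists>z. x i < z \<and> z < x (Suc i) \<and> poly (pderiv L) z = 0" if "i \<in> I" for i
  proof -
    have i: "Suc i < k" "i \<noteq> m - 1" using that by (auto simp: I_def)
    then have lt: "x i < x (Suc i)" using x by auto
    have "poly L (x (Suc i)) = poly L (x i)" using i m by (auto simp: L(1) y_def)
    then show ?thesis using poly_MVT[OF lt, of L] lt by auto
  qed
  then obtain z where z: "\<And>i. i \<in> I \<Longrightarrow> x i < z i \<and> z i < x (Suc i) \<and> poly (pderiv L) (z i) = 0"
    by metis
  have zmono: "z i < z j" if "i \<in> I" "j \<in> I" "i < j" for i j
  proof -
    have "x (Suc i) \<le> x j"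
    proof (cases "Suc i = j")
      case False
      then have "Suc i < j" "j < k" using that by (auto simp: I_def)
      then show ?thesis using x by (simp add: less_imp_le)
    qed simp
    then show ?thesis using z[OF that(1)] z[OF that(2)] by linarith
  qed
  have "inj_on z I"
    by (intro inj_onI) (metis less_irrefl linorder_neqE_nat zmono)
  then have "card (z ` I) = k - 2" using m by (simp add: card_image I_def)
  moreover have "pderiv L \<noteq> 0"
  proof
    assume "pderiv L = 0"
    then have "degree L = 0" by (simp add: pderiv_eq_0_iff)
    then obtain c where "L = [:c:]" by (rule degree_eq_zeroE)
    then show False using L(1)[of 0] L(1)[of "k - 1"] m k by (simp add: y_def split: if_splits)
  qed
  \<comment> \<open>The contradiction: \<open>k - 2\<close> roots of a nonzero polynomial of degree
    at most \<open>k - 3\<close>.\<close>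
  then have "card (z ` I) \<le> degree (pderiv L)"
    using z by (intro order_trans[OF card_mono card_poly_roots_bound] poly_roots_finite) auto
  ultimately show False using dL k by (simp add: degree_pderiv)
qed

text \<open>The coefficients are the weights of the divided difference, scaled to integers. Their
  sums over final segments are divided differences of step functions, hence nonzero;
  \<open>local_lift\<close> depends on this.\<close>

lemma relation_coefficients_exist:
  fixes a :: "int list"
  assumes a: "sorted_wrt (<) a" and k: "k = length a" "k \<ge> 3"
  shows "\<exists>c :: nat \<Rightarrow> int. (\<forall>i<k. c i \<noteq> 0) \<and>
    (\<forall>n d s. s + 2 \<le> k \<longrightarrow> (\<Sum>i<k. c i * (n + a ! i * d) ^ s) = 0) \<and>
    (\<forall>m. 0 < m \<and> m < k \<longrightarrow> (\<Sum>i\<in>{m..<k}. c i) \<noteq> 0)"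
proof -
  define x where "x i = real_of_int (a ! i)" for i
  have x: "x i < x j" if "i < j" "j < k" for i j
    using a that k(1) by (simp add: x_def sorted_wrt_nth_less)
  have inj: "inj_on x {..<k}"
    by (intro inj_onI) (metis lessThan_iff less_irrefl linorder_neqE_nat x)
  define w where "w i = (\<Prod>j\<in>{..<k} - {i}. a ! i - a ! j)" for i
  \<comment> \<open>This is \<open>W / w i\<close>: the common denominator \<open>W\<close> clears
    all the weights at once.\<close>
  define c where "c i = (\<Prod>m\<in>{..<k} - {i}. w m)" for i
  define W where "W = real_of_int (\<Prod>m<k. w m)"
  have wx: "real_of_int (w i) = (\<Prod>j\<in>{..<k} - {i}. x i - x j)" for i
    by (simp add: w_def x_def)
  have w0: "w i \<noteq> 0" if "i < k" for i
    using inj that by (auto simp: w_def x_def inj_on_def)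
  have W0: "W \<noteq> 0" using w0 by (auto simp: W_def)
  have c: "real_of_int (c i) = W * (1 / (\<Prod>j\<in>{..<k} - {i}. x i - x j))" if "i < k" for i
  proof -
    have "(\<Prod>m<k. w m) = w i * c i" unfolding c_def using that by (intro prod.remove) auto
    then have "W = real_of_int (w i) * real_of_int (c i)" unfolding W_def by simp
    then show ?thesis using w0[OF that] unfolding wx[symmetric] by simp
  qed
  have "c i \<noteq> 0" if "i < k" for i using w0 by (auto simp: c_def)
  moreover have "(\<Sum>i<k. c i * (n + a ! i * d) ^ s) = 0" if "s + 2 \<le> k" for n d s
  proof -
    define h where "h = [:real_of_int n, real_of_int d:] ^ s"
    have "degree h \<le> s" unfolding h_def
      using degree_power_le[of "[:real_of_int n, real_of_int d:]" s] by (auto split: if_splits)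
    then have "(\<Sum>i<k. poly h (x i) / (\<Prod>j\<in>{..<k} - {i}. x i - x j)) = 0"
      using that by (intro divided_difference_vanishes inj) auto
    moreover have "real_of_int (\<Sum>i<k. c i * (n + a ! i * d) ^ s) =
        W * (\<Sum>i<k. poly h (x i) / (\<Prod>j\<in>{..<k} - {i}. x i - x j))"
      unfolding of_int_sum sum_distrib_left
      by (intro sum.cong refl) (simp add: c h_def x_def)
    ultimately have "real_of_int (\<Sum>i<k. c i * (n + a ! i * d) ^ s) = 0"
      by (simp only: mult_zero_right)
    then show ?thesis unfolding of_int_eq_0_iff .
  qed
  moreover have "(\<Sum>i\<in>{m..<k}. c i) \<noteq> 0" if "0 < m" "m < k" for m
  proof -
    have "real_of_int (\<Sum>i\<in>{m..<k}. c i) = W * (\<Sum>i\<in>{m..<k}. 1 / (\<Prod>j\<in>{..<k} - {i}. x i - x j))"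
      unfolding of_int_sum sum_distrib_left by (intro sum.cong refl) (simp add: c)
    moreover have "(\<Sum>i\<in>{m..<k}. 1 / (\<Prod>j\<in>{..<k} - {i}. x i - x j)) \<noteq> 0"
      using x that k(2) by (rule divided_difference_step_nonzero)
    ultimately have "real_of_int (\<Sum>i\<in>{m..<k}. c i) \<noteq> 0" using W0 by (simp only: mult_eq_0_iff) simp
    then show ?thesis unfolding of_int_eq_0_iff .
  qed
  ultimately show ?thesis by blast
qed

subsection \<open>Encoding colors along the moment curve\<close>

text \<open>Uniqueness of expansions in base \<open>M\<close> with signed digits: modulo
  \<open>M\<close> only the lowest digit survives, and it is too small to be a nonzero multiple of
  \<open>M\<close>.\<close>

lemma digits_eq_0:
  fixes e :: "nat \<Rightarrow> int"
  assumes "\<And>j. j < k \<Longrightarrow> \<bar>e j\<bar> < M" "(\<Sum>j<k. e j * M ^ j) = 0" "j < k"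
  shows "e j = 0"
  using assms
proof (induction k arbitrary: e j)
  case (Suc k)
  have M: "M > 0" using Suc.prems(1)[of 0] by simp
  have s: "e 0 + M * (\<Sum>j<k. e (Suc j) * M ^ j) = 0"
    using Suc.prems(2) unfolding sum.lessThan_Suc_shift by (simp add: sum_distrib_left mult_ac)
  then have "M dvd e 0" by (metis add.commute add_eq_0_iff dvd_minus_iff dvd_triv_left)
  then have e0: "e 0 = 0" using Suc.prems(1)[of 0] dvd_imp_le_int[of "e 0" M] M by fastforce
  then have "(\<Sum>j<k. e (Suc j) * M ^ j) = 0" using s M by simp
  then have "e (Suc j) = 0" if "j < k" for j
    using Suc.IH[of "\<lambda>j. e (Suc j)" j] Suc.prems(1) that by simp
  then show ?case using e0 Suc.prems(3) by (cases j) auto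
qed simp

text \<open>Vanishing moments kill all polynomials in \<open>u\<close> of degree below
  \<open>k\<close>. As \<open>u\<close> takes at most \<open>k\<close> values, such a polynomial can
  isolate any one of them, so the \<open>c i\<close> sum to zero over every class of equal
  \<open>u\<close>.\<close>

lemma moment_curve_relation:
  fixes c :: "nat \<Rightarrow> int" and u :: "nat \<Rightarrow> int"
  assumes "\<And>j. j < k \<Longrightarrow> (\<Sum>i<k. c i * u i ^ j) = 0"
  shows "(\<Sum>i<k. c i * \<phi> (u i)) = (0 :: int)"
proof -
  define U where "U = u ` {..<k}"
  have poly0: "(\<Sum>i<k. c i * poly h (u i)) = 0" if "degree h < k" for h
  proof -
    have "(\<Sum>i<k. c i * poly h (u i)) = (\<Sum>j\<le>degree h. coeff h j * (\<Sum>i<k. c i * u i ^ j))"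
      unfolding poly_altdef sum_distrib_left by (subst sum.swap) (simp add: mult_ac)
    also have "\<dots> = 0" using assms that by (intro sum.neutral) auto
    finally show ?thesis .
  qed
  have cls: "(\<Sum>i\<in>{i\<in>{..<k}. u i = v}. c i) = 0" if v: "v \<in> U" for v
  proof -
    define h where "h = (\<Prod>\<beta>\<in>U - {v}. [:- \<beta>, 1:])"
    have "card U \<le> k" unfolding U_def using card_image_le[of "{..<k}" u] by simp
    moreover have "card U > 0" using v by (auto simp: U_def card_gt_0_iff)
    moreover have "degree h = card U - 1"
      unfolding h_def using v by (subst degree_prod_sum_eq) (auto simp: U_def)
    ultimately have "degree h < k" by simp
    from poly0[OF this] have "0 = (\<Sum>i<k. c i * poly h (u i))" by simp
    also have "\<dots> = (\<Sum>i<k. if u i = v then c i * poly h v else 0)"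
      by (intro sum.cong refl) (auto simp: h_def poly_prod U_def)
    also have "\<dots> = (\<Sum>i\<in>{i\<in>{..<k}. u i = v}. c i) * poly h v"
      by (simp add: sum.inter_filter[symmetric] sum_distrib_right)
    finally show ?thesis by (auto simp: h_def poly_prod U_def)
  qed
  have "(\<Sum>i<k. c i * \<phi> (u i)) = (\<Sum>v\<in>U. \<Sum>i\<in>{i\<in>{..<k}. u i = v}. c i * \<phi> (u i))"
    unfolding U_def by (rule sum.image_gen) simp
  also have "\<dots> = (\<Sum>v\<in>U. (\<Sum>i\<in>{i\<in>{..<k}. u i = v}. c i) * \<phi> v)"
    unfolding sum_distrib_right by (intro sum.cong refl) auto
  also have "\<dots> = 0" using cls by simp
  finally show ?thesis .
qed

text \<open>Packing the powers of \<open>u i\<close> as digits in base \<open>M\<close> turns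
  \<open>k\<close> moment equations into a single one. Each moment is smaller than \<open>M\<close>
  in absolute value, so the digits can be read off.\<close>

lemma moment_encoding:
  fixes c :: "nat \<Rightarrow> int" and u :: "nat \<Rightarrow> nat"
  assumes M: "M > (\<Sum>i<k. \<bar>c i\<bar>) * int G ^ k" and u: "\<And>i. i < k \<Longrightarrow> u i < G"
    and rel: "(\<Sum>i<k. c i * (\<Sum>j<k. int (u i) ^ j * M ^ j)) = 0"
  shows "(\<Sum>i<k. c i * \<phi> (u i)) = (0 :: int)"
proof -
  have "(\<Sum>i<k. c i * int (u i) ^ j) = 0" if j: "j < k" for j
  proof (rule digits_eq_0[OF _ _ j])
    show "\<bar>\<Sum>i<k. c i * int (u i) ^ j\<bar> < M" if "j < k" for j
    proof -
      have "\<bar>\<Sum>i<k. c i * int (u i) ^ j\<bar> \<le> (\<Sum>i<k. \<bar>c i\<bar> * int G ^ k)"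
      proof (intro order_trans[OF sum_abs] sum_mono)
        fix i assume i: "i \<in> {..<k}"
        have "int (u i) ^ j \<le> int G ^ j" using u[of i] i by (intro power_mono) auto
        also have "\<dots> \<le> int G ^ k" using u[of i] i that by (intro power_increasing) auto
        finally show "\<bar>c i * int (u i) ^ j\<bar> \<le> \<bar>c i\<bar> * int G ^ k"
          by (simp add: abs_mult mult_left_mono)
      qed
      then show ?thesis using M by (simp add: sum_distrib_right)
    qed
    show "(\<Sum>j<k. (\<Sum>i<k. c i * int (u i) ^ j) * M ^ j) = 0"
      using rel unfolding sum_distrib_left sum_distrib_right by (subst sum.swap) (simp add: mult.assoc)
  qed
  then show ?thesis using moment_curve_relation[of k c "\<lambda>i. int (u i)" "\<lambda>v. \<phi> (nat v)"] by simp
qed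

subsection \<open>Lifting progressions from residues to integers\<close>

text \<open>Two terms in the same arc of length \<open>q / R\<close> have nearby residues. Because
  \<open>L\<close> is a multiple of \<open>a ! i0 - a ! j0\<close>, this makes \<open>L * d\<close>
  congruent to a small \<open>e\<close>, so the dilated residues follow a short integer progression
  up to multiples of \<open>q\<close>. The relation \<open>half\<close> shows that this progression
  crosses no multiple of \<open>q / 2\<close>.\<close>

lemma local_lift:
  fixes a :: "int list" and n d q R L W :: int
  assumes a: "sorted_wrt (<) a" and k: "k = length a" and q: "q > 0" and L: "L > 0"
    and dvd: "\<And>i j. i < k \<Longrightarrow> j < k \<Longrightarrow> i \<noteq> j \<Longrightarrow> (a ! i - a ! j) dvd L"
    and W: "\<And>i j. i < k \<Longrightarrow> j < k \<Longrightarrow> \<bar>a ! i - a ! j\<bar> \<le> W" and R: "R \<ge> 2 * W * L" "R > 0"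
    and arcs: "i0 < k" "j0 < k" "i0 \<noteq> j0"
      "((n + a ! i0 * d) mod q) * R div q = ((n + a ! j0 * d) mod q) * R div q"
    and c: "(\<Sum>i<k. c i) = 0" "\<And>m. 0 < m \<Longrightarrow> m < k \<Longrightarrow> (\<Sum>i\<in>{m..<k}. c i) \<noteq> 0"
    and half: "(\<Sum>i<k. c i * (2 * ((L * (n + a ! i * d)) mod q) div q)) = 0"
  shows "\<exists>y e. (\<forall>i<k. (L * (n + a ! i * d)) mod q = y + a ! i * e) \<and> q dvd L * d - e"
proof -
  define t where "t = (n + a ! i0 * d) mod q - (n + a ! j0 * d) mod q"
  obtain l where l: "L = (a ! i0 - a ! j0) * l" using dvd arcs by (metis dvdE)
  define e where "e = l * t"
  have "R * \<bar>t\<bar> < q"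
  proof -
    let ?x = "((n + a ! i0 * d) mod q) * R" and ?y = "((n + a ! j0 * d) mod q) * R"
    have "?x = ?x div q * q + ?x mod q" "?y = ?y div q * q + ?y mod q" by simp_all
    then have "?x - ?y = ?x mod q - ?y mod q" using arcs(4) by (metis add_diff_cancel_left)
    moreover have "0 \<le> ?x mod q" "?x mod q < q" "0 \<le> ?y mod q" "?y mod q < q" using q by simp_all
    ultimately have "\<bar>?x - ?y\<bar> < q" by linarith
    moreover have "?x - ?y = R * t" by (simp add: t_def algebra_simps)
    ultimately show ?thesis using R(2) by (simp add: abs_mult)
  qed
  have "\<bar>l\<bar> \<le> L"
  proof -
    have "l dvd L" by (simp add: l)
    then show ?thesis using L dvd_imp_le_int[of L l] by simp
  qed
  have W0: "W \<ge> 0" using W[OF arcs(1,1)] by simp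
  \<comment> \<open>The whole progression has length below \<open>q / 2\<close>.\<close>
  have We: "2 * W * \<bar>e\<bar> < q"
  proof -
    have "2 * W * \<bar>e\<bar> \<le> 2 * W * (L * \<bar>t\<bar>)"
      unfolding e_def abs_mult using W0 \<open>\<bar>l\<bar> \<le> L\<close> by (intro mult_left_mono mult_right_mono) auto
    also have "\<dots> = (2 * W * L) * \<bar>t\<bar>" by simp
    also have "\<dots> \<le> R * \<bar>t\<bar>" using R by (intro mult_right_mono) auto
    finally show ?thesis using \<open>R * \<bar>t\<bar> < q\<close> by linarith
  qed
  have qe: "q dvd L * d - e"
  proof -
    have "q dvd ((n + a ! i0 * d) - (n + a ! j0 * d)) - t"
      unfolding t_def by (metis dvd_minus_mod mod_diff_eq mod_eq_dvd_iff mod_mod_trivial)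
    then have "q dvd l * (((n + a ! i0 * d) - (n + a ! j0 * d)) - t)" by simp
    moreover have "l * (((n + a ! i0 * d) - (n + a ! j0 * d)) - t) = L * d - e"
      by (simp add: l e_def algebra_simps)
    ultimately show ?thesis by simp
  qed
  define y0 where "y0 = (L * (n + a ! 0 * d)) mod q - a ! 0 * e"
  define Y where "Y i = y0 + a ! i * e" for i
  have Ymod: "(L * (n + a ! i * d)) mod q = Y i mod q" for i
  proof -
    obtain z where z: "L * d = e + q * z" using qe by (metis add.commute diff_add_cancel dvdE)
    have "L * (n + a ! i * d) = L * (n + a ! 0 * d) + (a ! i - a ! 0) * (L * d)"
      by (simp add: algebra_simps)
    also have "\<dots> = L * (n + a ! 0 * d) + (a ! i - a ! 0) * e + q * ((a ! i - a ! 0) * z)"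
      by (simp add: z algebra_simps)
    finally have "(L * (n + a ! i * d)) mod q = (L * (n + a ! 0 * d) + (a ! i - a ! 0) * e) mod q"
      by simp
    also have "\<dots> = ((L * (n + a ! 0 * d)) mod q + (a ! i - a ! 0) * e) mod q"
      by (simp add: mod_add_left_eq)
    finally show ?thesis by (simp add: Y_def y0_def algebra_simps)
  qed
  \<comment> \<open>The index of the half-period containing \<open>Y i\<close>; only its parity is
    visible in the residue.\<close>
  define \<Lambda> where "\<Lambda> i = 2 * Y i div q" for i
  have halfmod: "2 * (Y i mod q) div q = \<Lambda> i mod 2" for i
  proof -
    have "2 * Y i = 2 * (Y i mod q) + (2 * (Y i div q)) * q"
      by (metis distrib_left mod_mult_div_eq mult.assoc mult.commute)
    then have "\<Lambda> i = 2 * (Y i mod q) div q + 2 * (Y i div q)"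
      unfolding \<Lambda>_def using q by simp
    moreover have "2 * (Y i mod q) div q \<in> {0, 1}"
    proof -
      have r: "0 \<le> Y i mod q" "Y i mod q < q" using q by simp_all
      have "0 \<le> 2 * (Y i mod q) div q" using r q by (simp add: pos_imp_zdiv_nonneg_iff)
      moreover have "2 * (Y i mod q) div q * q \<le> 2 * (Y i mod q)"
        using div_mult_mod_eq[of "2 * (Y i mod q)" q] pos_mod_sign[of q "2 * (Y i mod q)"] q by linarith
      then have "2 * (Y i mod q) div q * q < 2 * q" using r by linarith
      then have "2 * (Y i mod q) div q < 2" using q by simp
      ultimately show ?thesis by auto
    qed
    ultimately show ?thesis by auto
  qed
  have close: "\<Lambda> j \<le> \<Lambda> i + 1" if "i < k" "j < k" for i j
  proof -
    have "2 * (Y j - Y i) \<le> 2 * (\<bar>a ! j - a ! i\<bar> * \<bar>e\<bar>)"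
      by (simp add: Y_def abs_mult[symmetric] left_diff_distrib[symmetric])
    also have "\<dots> \<le> 2 * (W * \<bar>e\<bar>)" using W that by (intro mult_left_mono mult_right_mono) auto
    finally have "2 * Y j \<le> 2 * Y i + q" using We by (simp add: mult.assoc)
    then have "\<Lambda> j \<le> (2 * Y i + q) div q" unfolding \<Lambda>_def using q by (intro zdiv_mono1)
    then show ?thesis using q by (simp add: \<Lambda>_def)
  qed
  have k0: "0 < k" using arcs by simp
  \<comment> \<open>\<open>\<Lambda>\<close> is monotone along the progression, in the direction
    given by the sign of \<open>e\<close>; once it leaves its initial value it never
    returns.\<close>
  have mono: "\<Lambda> i = \<Lambda> 0" if "i \<le> j" "j < k" "\<Lambda> j = \<Lambda> 0" for i j
  proof -
    have le: "a ! i \<le> a ! j" if "i \<le> j" "j < k" for i j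
      using a that k by (cases "i = j") (auto simp: sorted_wrt_nth_less less_imp_le)
    show ?thesis
    proof (cases "e \<ge> 0")
      case True
      have "\<Lambda> i \<le> \<Lambda> j" if "i \<le> j" "j < k" for i j
        unfolding \<Lambda>_def Y_def using q True le[OF that] by (intro zdiv_mono1) (auto intro: mult_right_mono)
      from this[of 0 i] this[of i j] show ?thesis using that by simp
    next
      case False
      have "\<Lambda> j \<le> \<Lambda> i" if "i \<le> j" "j < k" for i j
        unfolding \<Lambda>_def Y_def using q False le[OF that]
        by (intro zdiv_mono1) (auto intro: mult_right_mono_neg)
      from this[of 0 i] this[of i j] show ?thesis using that by simp
    qed
  qed
  have const: "\<Lambda> i = \<Lambda> 0" if "i < k" for i
  proof (rule ccontr)
    assume "\<Lambda> i \<noteq> \<Lambda> 0"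
    define m where "m = (LEAST i. \<Lambda> i \<noteq> \<Lambda> 0)"
    have m: "\<Lambda> m \<noteq> \<Lambda> 0" unfolding m_def by (rule LeastI, fact)
    have mk: "m < k" unfolding m_def using \<open>\<Lambda> i \<noteq> \<Lambda> 0\<close> that by (meson Least_le le_less_trans)
    have m0: "m > 0" using m by (cases m) auto
    have iff: "\<Lambda> j = \<Lambda> 0 \<longleftrightarrow> j < m" if "j < k" for j
      using mono[of m j] m that not_less_Least[of j "\<lambda>i. \<Lambda> i \<noteq> \<Lambda> 0"]
      unfolding m_def[symmetric] by (meson not_le)
    define \<beta> where "\<beta> = \<Lambda> 0 mod 2"
    \<comment> \<open>From \<open>m\<close> on the index has moved by exactly one, so its parity is
      opposite to \<open>\<beta>\<close>. The relation then reduces to a nonzero multiple of a final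
      partial sum of \<open>c\<close>.\<close>
    have hm: "\<Lambda> j mod 2 = \<beta> + (if j < m then 0 else 1 - 2 * \<beta>)" if "j < k" for j
    proof (cases "j < m")
      case False
      then have "\<Lambda> j = \<Lambda> 0 + 1 \<or> \<Lambda> j = \<Lambda> 0 - 1"
        using iff[OF that] close[OF that k0] close[OF k0 that] by linarith
      then have "\<Lambda> j mod 2 = 1 - \<beta>" unfolding \<beta>_def by presburger
      then show ?thesis using False by simp
    qed (use iff[OF that] in \<open>simp add: \<beta>_def\<close>)
    have "0 = (\<Sum>i<k. c i * (\<Lambda> i mod 2))" using half by (simp add: Ymod halfmod)
    also have "\<dots> = (\<Sum>i<k. c i * \<beta> + (if i < m then 0 else c i * (1 - 2 * \<beta>)))"
      by (intro sum.cong refl) (simp add: hm distrib_left)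
    also have "\<dots> = (\<Sum>i<k. c i) * \<beta> + (\<Sum>i<k. if i < m then 0 else c i * (1 - 2 * \<beta>))"
      by (simp add: sum.distrib sum_distrib_right)
    also have "(\<Sum>i<k. if i < m then 0 else c i * (1 - 2 * \<beta>)) = (\<Sum>i\<in>{m..<k}. c i * (1 - 2 * \<beta>))"
      using mk by (intro sum.mono_neutral_cong_right) auto
    also have "\<dots> = (\<Sum>i\<in>{m..<k}. c i) * (1 - 2 * \<beta>)" by (simp add: sum_distrib_right)
    finally have "(\<Sum>i\<in>{m..<k}. c i) * (1 - 2 * \<beta>) = 0" using c(1) by simp
    moreover have "1 - 2 * \<beta> \<noteq> 0" by presburger
    ultimately show False using c(2)[OF m0 mk] by simp
  qed
  \<comment> \<open>All terms lie in one half-period, so reduction subtracts the same multiple of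
    \<open>q\<close> from each.\<close>
  have "Y i mod q = Y i - \<Lambda> 0 div 2 * q" if "i < k" for i
  proof -
    have "Y i div q = \<Lambda> i div 2" unfolding \<Lambda>_def
      by (subst zdiv_zmult2_eq[symmetric]) (simp_all add: mult.commute)
    then show ?thesis using const[OF that] by (simp add: minus_div_mult_eq_mod[symmetric])
  qed
  then have lift: "(L * (n + a ! i * d)) mod q = (y0 - \<Lambda> 0 div 2 * q) + a ! i * e" if "i < k" for i
    using that by (simp add: Ymod Y_def)
  show ?thesis
  proof (intro exI conjI allI impI)
    show "(L * (n + a ! i * d)) mod q = (y0 - \<Lambda> 0 div 2 * q) + a ! i * e" if "i < k" for i
      by (rule lift[OF that])
  qed (rule qe)
qed

text \<open>A nondegenerate quadratic takes each value at most twice, so color classes without singletons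
  are pairs reflected about the vertex; comparing with the sum of the \<open>a\<^sub>i\<close>, the reflection is the
  symmetry of the tuple.\<close>

lemma quadratic_pairing:
  fixes a :: "int list" and A B E :: int
  assumes a: "sorted_wrt (<) a" and sym: "symmetric_tuple a" and k: "k = length a" "k > 0" and E: "E \<noteq> 0"
    and partner: "\<And>i. i < k \<Longrightarrow> \<exists>j<k. j \<noteq> i \<and> col i = col j"
    and quad: "\<And>i j. i < k \<Longrightarrow> j < k \<Longrightarrow> col i = col j \<Longrightarrow>
      A + B * (a ! i) + E * (a ! i)^2 = A + B * (a ! j) + E * (a ! j)^2"
    and i: "i < k"
  shows "col i = col (k - 1 - i)"
proof -
  obtain \<tau> where \<tau>: "\<And>i. i < k \<Longrightarrow> \<tau> i < k \<and> \<tau> i \<noteq> i \<and> col i = col (\<tau> i)"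
    using partner by metis
  have inja: "i = j" if "a ! i = a ! j" "i < k" "j < k" for i j
    using a that k by (metis less_irrefl linorder_neqE_nat sorted_wrt_nth_less)
  have vertex: "E * (a ! i + a ! (\<tau> i)) = - B" if "i < k" for i
  proof -
    have "(a ! i - a ! (\<tau> i)) * (B + E * (a ! i + a ! (\<tau> i))) = 0"
      using quad[of i "\<tau> i"] \<tau>[OF that] that by (simp add: algebra_simps power2_eq_square)
    moreover have "a ! i \<noteq> a ! (\<tau> i)" using inja[of i "\<tau> i"] \<tau>[OF that] that by auto
    ultimately show ?thesis by simp
  qed
  define S where "S = a ! 0 + a ! (\<tau> 0)"
  have S: "a ! (\<tau> i) = S - a ! i" if "i < k" for i
  proof -
    have "E * (a ! i + a ! (\<tau> i)) = E * S" using vertex[OF that] vertex[OF k(2)] by (simp add: S_def)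
    then show ?thesis using E by simp
  qed
  obtain s where s: "\<And>i. i < k \<Longrightarrow> a ! i + a ! (k - 1 - i) = s"
    using sym k by (auto simp: symmetric_tuple_def)
  \<comment> \<open>Once \<open>\<tau>\<close> is a permutation, summing
    \<open>a ! (\<tau> i) = S - a ! i\<close> determines \<open>S\<close>; the symmetry of the tuple
    yields the same equation for \<open>s\<close>.\<close>
  have inj: "inj_on \<tau> {..<k}"
  proof (rule inj_onI)
    fix i j assume "i \<in> {..<k}" "j \<in> {..<k}" "\<tau> i = \<tau> j"
    then show "i = j" using S[of i] S[of j] inja[of i j] by auto
  qed
  moreover have "\<tau> ` {..<k} \<subseteq> {..<k}" using \<tau> by auto
  ultimately have "\<tau> ` {..<k} = {..<k}" by (simp add: endo_inj_surj)
  then have "(\<Sum>i<k. a ! (\<tau> i)) = (\<Sum>i<k. a ! i)"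
    using sum.reindex[OF inj, of "\<lambda>i. a ! i"] by simp
  moreover have "(\<Sum>i<k. a ! (\<tau> i)) = int k * S - (\<Sum>i<k. a ! i)"
    using S by (simp add: sum_subtractf)
  moreover have "(\<Sum>i<k. a ! (k - 1 - i)) = (\<Sum>i<k. a ! i)"
    by (rule sum.reindex_bij_witness[of _ "\<lambda>i. k - 1 - i" "\<lambda>i. k - 1 - i"]) auto
  moreover have "(\<Sum>i<k. a ! i + a ! (k - 1 - i)) = int k * s" using s by simp
  ultimately have "int k * S = int k * s" by (simp add: sum.distrib)
  then have "S = s" using k by simp
  then have "a ! (\<tau> i) = a ! (k - 1 - i)" using S[OF i] s[OF i] by simp
  then have "\<tau> i = k - 1 - i" using inja[of "\<tau> i" "k - 1 - i"] \<tau>[OF i] i by simp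
  then show ?thesis using \<tau>[OF i] by simp
qed

subsection \<open>The coloring of residues\<close>

text \<open>Arcs are recorded for undilated residues and halves for dilated ones, matching the
  hypotheses of \<open>local_lift\<close>. The \<open>1 +\<close> moves residues into the domain
  \<open>{1..q 0}\<close> of the given coloring. Leaving the large modulus \<open>q 0\<close> out of
  the norm keeps the number of colors small.\<close>

definition residue_color ::
  "(nat \<Rightarrow> int) \<Rightarrow> nat \<Rightarrow> int \<Rightarrow> int \<Rightarrow> (int \<Rightarrow> nat) \<Rightarrow> int \<Rightarrow> nat \<times> int \<times> (int \<times> int) list" where
  "residue_color q D L R c x =
    (c (1 + (L * x) mod q 0),
     (\<Sum>j\<in>{1..D}. ((L * x) mod q j)^2),
     map (\<lambda>j. ((x mod q j) * R div q j, 2 * ((L * x) mod q j) div q j)) [0..<Suc D])"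

lemma residue_color_periodic:
  assumes "\<And>j. j \<le> D \<Longrightarrow> q j dvd Q"
  shows "residue_color q D L R c (x + Q) = residue_color q D L R c x"
proof -
  have 1: "(x + Q) mod q j = x mod q j" if "j \<le> D" for j
    using assms[OF that] by (metis add.right_neutral dvd_imp_mod_0 mod_add_right_eq)
  have 2: "(L * (x + Q)) mod q j = (L * x) mod q j" if "j \<le> D" for j
    using 1[OF that] by (metis mod_mult_right_eq)
  show ?thesis unfolding residue_color_def
    using 1 2 by (auto intro!: sum.cong)
qed

lemma mult_div_bounds:
  fixes x q R :: int
  assumes "0 \<le> x" "x < q" "0 < R"
  shows "0 \<le> x * R div q" "x * R div q < R"
proof -
  show "0 \<le> x * R div q" using assms by (simp add: pos_imp_zdiv_nonneg_iff)
  have "x * R div q * q \<le> x * R"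
    using div_mult_mod_eq[of "x * R" q] pos_mod_sign[of q "x * R"] assms by linarith
  also have "\<dots> < q * R" using assms by simp
  finally have "x * R div q * q < R * q" by (simp add: mult.commute)
  then show "x * R div q < R" using assms by simp
qed

text \<open>A finite palette, to be counted. Only \<open>q 1\<close> to \<open>q D\<close> need the
  bound \<open>B\<close>, as only they enter the norm.\<close>

lemma residue_color_in:
  assumes q: "\<And>j. j \<le> D \<Longrightarrow> q j > 0" "\<And>j. 1 \<le> j \<Longrightarrow> j \<le> D \<Longrightarrow> q j \<le> B"
    and R: "R > 0" and c: "c ` {1..q 0} \<subseteq> {..<r}"
  shows "residue_color q D L R c x \<in>
    {..<r} \<times> {0..int D * B^2} \<times> {xs. set xs \<subseteq> {0..<R} \<times> {0..<2} \<and> length xs = Suc D}"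
proof -
  have m: "0 \<le> z mod q j" "z mod q j < q j" if "j \<le> D" for z j using q(1)[OF that] by simp_all
  have "1 + (L * x) mod q 0 \<in> {1..q 0}" using m[of 0 "L * x"] by auto
  then have "c (1 + (L * x) mod q 0) < r" using c by blast
  moreover have "(\<Sum>j\<in>{1..D}. ((L * x) mod q j)^2) \<le> (\<Sum>j\<in>{1..D}. B^2)"
  proof (rule sum_mono)
    fix j assume "j \<in> {1..D}"
    then show "((L * x) mod q j)^2 \<le> B^2"
      using m[of j "L * x"] q(2)[of j] by (intro power_mono) auto
  qed
  moreover have "(\<Sum>j\<in>{1..D}. ((L * x) mod q j)^2) \<ge> 0" by (intro sum_nonneg) auto
  moreover have "(x mod q j) * R div q j \<in> {0..<R}" "2 * ((L * x) mod q j) div q j \<in> {0..<2}" if "j \<le> D" for j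
    using mult_div_bounds[OF m[OF that] R, of x] mult_div_bounds[OF m[OF that], of 2 "L * x"]
    by (auto simp: mult.commute)
  ultimately show ?thesis unfolding residue_color_def by auto
qed

text \<open>Otherwise the residues for every modulus lift to an integer progression of step
  \<open>e j\<close>, with \<open>e 0 \<noteq> 0\<close> and some further
  \<open>e j \<noteq> 0\<close>. The norm is then a genuine quadratic, so colors pair up by
  reflection, and the first component exhibits a forbidden symmetrically colored AP.\<close>

lemma residue_color_relation:
  fixes a :: "int list" and cf :: "nat \<Rightarrow> int" and n d L R W :: int
  assumes a: "sorted_wrt (<) a" and sym: "symmetric_tuple a" and k: "k = length a" "k \<ge> 2"
    and cf: "\<And>i. i < k \<Longrightarrow> cf i \<noteq> 0" "(\<Sum>i<k. cf i) = 0"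
      "\<And>m. 0 < m \<Longrightarrow> m < k \<Longrightarrow> (\<Sum>i\<in>{m..<k}. cf i) \<noteq> 0"
    and q: "\<And>j. j \<le> D \<Longrightarrow> q j > 0" "\<And>j. j \<le> D \<Longrightarrow> coprime (q j) L"
    and L: "L > 0" "\<And>i j. i < k \<Longrightarrow> j < k \<Longrightarrow> i \<noteq> j \<Longrightarrow> (a ! i - a ! j) dvd L"
    and W: "\<And>i j. i < k \<Longrightarrow> j < k \<Longrightarrow> \<bar>a ! i - a ! j\<bar> \<le> W" and R: "R \<ge> 2 * W * L" "R > 0"
    and no_AP: "\<And>n d. \<not> sym_colored_AP a c (nat (q 0)) n d"
    and rel: "\<And>\<phi>. (\<Sum>i<k. cf i * \<phi> (residue_color q D L R c (n + a ! i * d))) = 0"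
  shows "q 0 dvd d \<or> (\<forall>j\<in>{1..D}. q j dvd d)"
proof (rule ccontr)
  assume contra: "\<not> ?thesis"
  define x where "x i = n + a ! i * d" for i
  define col where "col i = residue_color q D L R c (x i)" for i
  \<comment> \<open>Test the relation on the indicator of one color: a singleton class would force
    \<open>cf i = 0\<close>.\<close>
  have partner: "\<exists>j<k. j \<noteq> i \<and> col i = col j" if "i < k" for i
  proof (rule ccontr)
    assume "\<not> ?thesis"
    then have "(\<Sum>j<k. cf j * (if col j = col i then 1 else 0)) = (\<Sum>j<k. if j = i then cf i else 0)"
      by (intro sum.cong refl) auto
    also have "\<dots> = cf i" using that by simp
    finally show False
      using rel[of "\<lambda>z. if z = col i then 1 else 0"] cf(1)[OF that] by (simp add: col_def x_def)
  qed
  have "\<exists>y e. (\<forall>i<k. (L * x i) mod q j = y + a ! i * e) \<and> q j dvd L * d - e" if j: "j \<le> D" for j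
  proof -
    obtain j0 where j0: "j0 < k" "j0 \<noteq> 0" "col 0 = col j0" using partner[of 0] k(2) by fastforce
    have nth: "snd (snd (col i)) ! j = ((x i mod q j) * R div q j, 2 * ((L * x i) mod q j) div q j)" for i
      using j unfolding col_def residue_color_def by (simp del: upt_Suc)
    have "(x 0 mod q j) * R div q j = (x j0 mod q j) * R div q j"
      using nth[of 0] nth[of j0] j0(3) by simp
    moreover have "(\<Sum>i<k. cf i * (2 * ((L * x i) mod q j) div q j)) = 0"
      using rel[of "\<lambda>z. snd (snd (snd z) ! j)"] by (simp add: nth col_def[symmetric] x_def[symmetric])
    ultimately show ?thesis unfolding x_def
      using k j0 by (intro local_lift[OF a k(1) q(1)[OF j] L W R, of 0 j0 _ _ cf] cf) auto
  qed
  then obtain y e where lift: "\<And>j i. j \<le> D \<Longrightarrow> i < k \<Longrightarrow> (L * x i) mod q j = y j + a ! i * e j"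
    and qe: "\<And>j. j \<le> D \<Longrightarrow> q j dvd L * d - e j" by metis
  \<comment> \<open>\<open>L\<close> is invertible modulo \<open>q j\<close>, so a zero step means
    that \<open>q j\<close> divides \<open>d\<close>.\<close>
  have e0: "e j \<noteq> 0" if "j \<le> D" "\<not> q j dvd d" for j
    using qe[OF that(1)] q(2)[OF that(1)] that(2) by (auto simp: coprime_dvd_mult_right_iff)
  obtain j1 where j1: "j1 \<in> {1..D}" "\<not> q j1 dvd d" using contra by auto
  have "e 0 \<noteq> 0" using e0 contra by auto
  define E where "E = (\<Sum>j\<in>{1..D}. (e j)^2)"
  define A where "A = (\<Sum>j\<in>{1..D}. (y j)^2)"
  define B where "B = (\<Sum>j\<in>{1..D}. 2 * y j * e j)"
  \<comment> \<open>The leading coefficient is a sum of squares, so one nonzero step is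
    enough.\<close>
  have "0 < (e j1)^2" using e0[of j1] j1 by simp
  also have "\<dots> \<le> E" unfolding E_def using j1 by (intro member_le_sum) auto
  finally have "E \<noteq> 0" by simp
  have norm: "fst (snd (col i)) = A + B * (a ! i) + E * (a ! i)^2" if "i < k" for i
  proof -
    have "fst (snd (col i)) = (\<Sum>j\<in>{1..D}. (y j + a ! i * e j)^2)"
      unfolding col_def residue_color_def using lift that by (auto intro!: sum.cong)
    also have "\<dots> = (\<Sum>j\<in>{1..D}. (y j)^2 + (2 * y j * e j) * (a ! i) + (e j)^2 * (a ! i)^2)"
      by (intro sum.cong refl) (simp add: power2_eq_square algebra_simps)
    finally show ?thesis by (simp add: A_def B_def E_def sum.distrib sum_distrib_right)
  qed
  have mirror: "col i = col (k - 1 - i)" if "i < k" for i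
  proof (rule quadratic_pairing[OF a sym k(1) _ \<open>E \<noteq> 0\<close> partner _ that])
    show "A + B * a ! i + E * (a ! i)\<^sup>2 = A + B * a ! j + E * (a ! j)\<^sup>2"
      if "i < k" "j < k" "col i = col j" for i j
      using norm[OF that(1)] norm[OF that(2)] that(3) by simp
  qed (use k in auto)
  have pos: "1 + y 0 + a ! i * e 0 = 1 + (L * x i) mod q 0" if "i < k" for i
    using lift[of 0 i] that by simp
  have "sym_colored_AP a c (nat (q 0)) (1 + y 0) (e 0)"
    unfolding sym_colored_AP_def k(1)[symmetric]
  proof (intro conjI allI impI)
    show "1 + y 0 + a ! i * e 0 \<in> {1..int (nat (q 0))}" if "i < k" for i
      unfolding pos[OF that] using q(1)[of 0] by (auto simp: add1_zle_eq add.commute[of 1])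
    show "c (1 + y 0 + a ! i * e 0) = c (1 + y 0 + a ! (k - 1 - i) * e 0)" if "i < k div 2" for i
    proof -
      have i: "i < k" "k - 1 - i < k" using that by auto
      have "fst (col i) = fst (col (k - 1 - i))" using mirror[OF i(1)] by simp
      then show ?thesis
        unfolding pos[OF i(1)] pos[OF i(2)] by (simp add: col_def residue_color_def)
    qed
  qed fact
  then show False using no_AP by blast
qed

section \<open>Choice of moduli and density of degenerate differences\<close>

lemma card_multiples:
  fixes q :: nat
  assumes "q > 0" "q dvd Q"
  shows "card {d\<in>{0..<int Q}. int q dvd d} * q = Q"
proof -
  obtain m where m: "Q = q * m" using assms by auto
  have "{d\<in>{0..<int Q}. int q dvd d} = (\<lambda>i. int q * int i) ` {..<m}"
  proof (intro equalityI subsetI)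
    fix d assume "d \<in> {d\<in>{0..<int Q}. int q dvd d}"
    then obtain z where z: "d = int q * z" "0 \<le> d" "d < int q * int m" using m by auto
    then have "0 \<le> z" "z < int m" using assms by (auto simp: zero_le_mult_iff)
    then show "d \<in> (\<lambda>i. int q * int i) ` {..<m}"
      using z by (intro image_eqI[of _ _ "nat z"]) auto
  qed (use assms in \<open>auto simp: m\<close>)
  then show ?thesis using assms by (simp add: card_image inj_on_def m)
qed

lemma prod_dvd_of_coprime:
  fixes q :: "nat \<Rightarrow> int"
  assumes "\<And>i j. i \<in> I \<Longrightarrow> j \<in> I \<Longrightarrow> i \<noteq> j \<Longrightarrow> coprime (q i) (q j)" "\<And>j. j \<in> I \<Longrightarrow> q j dvd d" "finite I"
  shows "prod q I dvd d"
  using assms(3,1,2)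
proof (induction I rule: finite_induct)
  case (insert j I)
  have "coprime (q j) (prod q I)" using insert by (intro prod_coprime_right) auto
  moreover have "q j dvd d" "prod q I dvd d" using insert by auto
  ultimately show ?case using insert by (simp add: divides_mult)
qed simp

text \<open>These are the moduli of Goedel's beta function.\<close>

lemma coprime_beta_moduli:
  fixes Y :: nat
  assumes "i \<in> {1..D}" "j \<in> {1..D}" "i \<noteq> j" "fact D dvd Y"
  shows "coprime (1 + i * Y) (1 + j * Y)"
  using assms(1-3)
proof (induction i j rule: linorder_wlog)
  case (sym i j)
  then show ?case by (simp add: coprime_commute)
next
  case (le i j)
  show ?case
  proof (rule ccontr)
    assume "\<not> coprime (1 + i * Y) (1 + j * Y)"
    then obtain m where m: "m dvd 1 + i * Y" "m dvd 1 + j * Y" "\<not> is_unit m"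
      by (rule not_coprimeE)
    then obtain l where "prime l" "l dvd m" using prime_factor_nat[of m] by auto
    then have l: "prime l" "l dvd 1 + i * Y" "l dvd 1 + j * Y" using m by (auto intro: dvd_trans)
    have nY: "\<not> l dvd Y"
    proof
      assume "l dvd Y"
      then have "l dvd 1" using l(2) by (metis dvd_add_left_iff dvd_mult)
      then show False using l(1) by auto
    qed
    have "l dvd (1 + j * Y) - (1 + i * Y)" using l by (intro dvd_diff_nat)
    also have "(1 + j * Y) - (1 + i * Y) = (j - i) * Y" by (simp add: diff_mult_distrib)
    finally have "l dvd j - i" using l(1) nY by (simp add: prime_dvd_mult_iff)
    also have "(j - i) dvd fact D" using le by (intro dvd_fact) auto
    finally show False using nY assms(4) by (auto dest: dvd_trans)
  qed
qed

text \<open>In \<open>Y\<close>, the factor \<open>fact D\<close> makes \<open>q 1\<close> to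
  \<open>q D\<close> pairwise coprime and \<open>L\<close> makes them coprime to the dilation. Each
  exceeds \<open>Y'\<close>, so the \<open>d\<close> divisible by all of them have density at most
  \<open>1 / Y' ^ D\<close>; \<open>q0\<close> exceeds their product, so its multiples are as
  rare.\<close>

lemma coloring_at_scale:
  fixes a :: "int list" and cf :: "nat \<Rightarrow> int" and r :: "nat \<Rightarrow> nat" and L W R D Y' :: nat
  assumes a: "sorted_wrt (<) a" and sym: "symmetric_tuple a" and k: "k = length a" "k \<ge> 2"
    and cf: "\<And>i. i < k \<Longrightarrow> cf i \<noteq> 0" "(\<Sum>i<k. cf i) = 0"
      "\<And>m. 0 < m \<Longrightarrow> m < k \<Longrightarrow> (\<Sum>i\<in>{m..<k}. cf i) \<noteq> 0"
    and r: "\<And>N. N \<ge> 1 \<Longrightarrow> \<exists>c. c ` {1..int N} \<subseteq> {..<r N} \<and> \<not> (\<exists>n d. sym_colored_AP a c N n d)"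
    and W: "\<And>i j. i < k \<Longrightarrow> j < k \<Longrightarrow> \<bar>a ! i - a ! j\<bar> \<le> int W"
    and D: "D \<ge> 1" and Y': "Y' \<ge> 1"
  defines "L \<equiv> fact W" and "R \<equiv> 2 * W * L + 1" and "Y \<equiv> fact D * L * Y'"
  shows "\<exists>q0 Q (u :: int \<Rightarrow> nat) Bad. Y' \<le> q0 \<and> q0 \<le> 2 * L * (2 * D * Y) ^ D \<and> Q > 0 \<and>
    (\<forall>x. u x < r q0 * (D * (2 * D * Y)^2 + 1) * (2 * R) ^ Suc D) \<and> (\<forall>x. u (x + int Q) = u x) \<and>
    Bad \<subseteq> {0..<int Q} \<and> card Bad * Y' ^ D \<le> 2 * Q \<and>
    (\<forall>n d. (\<forall>\<phi> :: nat \<Rightarrow> int. (\<Sum>i<k. cf i * \<phi> (u (n + a ! i * d))) = 0) \<longrightarrow> d mod int Q \<in> Bad)"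
proof -
  have L0: "L \<ge> 1" by (simp add: L_def fact_ge_1)
  have Y1: "Y \<ge> Y'" "Y \<ge> 1" using L0 Y' by (auto simp: Y_def Suc_le_eq)
  define P where "P = (\<Prod>j\<in>{1..D}. 1 + j * Y)"
  \<comment> \<open>Congruent to 1 modulo \<open>L\<close>, hence coprime to it, and only a constant
    factor above \<open>P\<close>, which keeps \<open>r q0\<close> under control.\<close>
  define q0 where "q0 = 1 + L * P"
  define q where "q j = (if j = 0 then q0 else 1 + j * Y)" for j
  define Q where "Q = q0 * P"
  have qj: "q j = 1 + j * Y" if "j \<in> {1..D}" for j using that by (simp add: q_def)
  have Pq: "P = (\<Prod>j\<in>{1..D}. q j)" unfolding P_def by (intro prod.cong refl) (auto simp: q_def)
  have P0: "P > 0" by (simp add: P_def)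
  have qpos: "q j > 0" for j by (simp add: q_def q0_def)
  have "(\<Prod>j\<in>{1..D}. Y) \<le> P" unfolding P_def
  proof (intro prod_mono conjI)
    fix j assume "j \<in> {1..D}"
    then have "1 * Y \<le> j * Y" by (intro mult_le_mono1) auto
    then show "Y \<le> 1 + j * Y" by linarith
  qed auto
  then have YP: "Y ^ D \<le> P" by simp
  have "P \<le> (\<Prod>j\<in>{1..D}. 2 * D * Y)" unfolding P_def
  proof (intro prod_mono conjI)
    fix j assume j: "j \<in> {1..D}"
    have "1 + j * Y \<le> D * Y + D * Y" using j D Y1 by (intro add_mono mult_right_mono) auto
    then show "1 + j * Y \<le> 2 * D * Y" by simp
  qed auto
  then have PY: "P \<le> (2 * D * Y) ^ D" by simp
  have qB: "q j \<le> 2 * D * Y" if "j \<in> {1..D}" for j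
  proof -
    have "1 + j * Y \<le> D * Y + D * Y" using that D Y1 by (intro add_mono mult_right_mono) auto
    then show ?thesis using qj[OF that] by simp
  qed
  have cop: "coprime (q i) (q j)" if "i \<in> {1..D}" "j \<in> {1..D}" "i \<noteq> j" for i j
    unfolding qj[OF that(1)] qj[OF that(2)] using that by (intro coprime_beta_moduli) (auto simp: Y_def)
  have copL: "coprime (q j) L" for j
  proof -
    have "q j = 1 + L * (if j = 0 then P else j * (fact D * Y'))"
      by (simp add: q_def q0_def Y_def mult_ac)
    then show ?thesis by (metis coprime_1_left coprime_iff_gcd_eq_1 gcd.commute gcd_add_mult mult.commute add.commute)
  qed
  obtain c where c: "c ` {1..int q0} \<subseteq> {..<r q0}" "\<And>n d. \<not> sym_colored_AP a c q0 n d"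
    using r[of q0] by (auto simp: q0_def)
  define col where "col = residue_color (\<lambda>j. int (q j)) D (int L) (int R) c"
  define \<Gamma> where "\<Gamma> = {..<r q0} \<times> {0..int D * (int (2 * D * Y))^2} \<times>
    {xs :: (int \<times> int) list. set xs \<subseteq> {0..<int R} \<times> {0..<2} \<and> length xs = Suc D}"
  have fin: "finite \<Gamma>" unfolding \<Gamma>_def by (intro finite_cartesian_product finite_lists_length_eq) auto
  have "card \<Gamma> = r q0 * (nat (int D * (int (2 * D * Y))^2 + 1) * card ({0..<int R} \<times> {0..<2::int}) ^ Suc D)"
    unfolding \<Gamma>_def by (simp only: card_cartesian_product card_lists_length_eq finite_cartesian_product
      finite_atLeastLessThan_int card_lessThan card_atLeastAtMost_int diff_zero)
  also have "int D * (int (2 * D * Y))^2 + 1 = int (D * (2 * D * Y)^2 + 1)" by simp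
  also have "card ({0..<int R} \<times> {0..<2::int}) = 2 * R" by (simp add: card_cartesian_product)
  finally have card\<Gamma>: "card \<Gamma> = r q0 * (D * (2 * D * Y)^2 + 1) * (2 * R) ^ Suc D"
    by (simp only: nat_int mult.assoc)
  have R0: "R > 0" by (simp add: R_def)
  have col\<Gamma>: "col x \<in> \<Gamma>" for x
    unfolding col_def \<Gamma>_def
  proof (rule residue_color_in)
    show "int (q j) \<le> int (2 * D * Y)" if "1 \<le> j" "j \<le> D" for j
      using qB[of j] that by (simp only: of_nat_le_iff atLeastAtMost_iff simp_thms)
    show "c ` {1..int (q 0)} \<subseteq> {..<r q0}" using c(1) by (simp add: q_def)
  qed (use qpos R0 in auto)
  \<comment> \<open>Numbers the colors, so that they can be placed on the moment curve.\<close>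
  obtain h where h: "bij_betw h \<Gamma> {0..<card \<Gamma>}" using ex_bij_betw_finite_nat[OF fin] by blast
  define u where "u x = h (col x)" for x
  define Bad where "Bad = {d\<in>{0..<int Q}. int q0 dvd d} \<union> {d\<in>{0..<int Q}. int P dvd d}"
  have qQ: "q j dvd Q" if "j \<le> D" for j
  proof (cases "j = 0")
    case False
    then have "q j dvd P" unfolding Pq using that by (intro dvd_prodI) auto
    then show ?thesis by (simp add: Q_def)
  qed (simp add: q_def Q_def)
  have Q0: "Q > 0" using P0 by (simp add: Q_def q0_def)
  show ?thesis
  proof (rule exI[of _ q0], rule exI[of _ Q], rule exI[of _ u], rule exI[of _ Bad], intro conjI allI impI)
    have "Y' \<le> Y ^ D" using Y1 D self_le_power[of Y D] by linarith
    also have "\<dots> \<le> L * P" using YP L0 by (metis le_trans mult_le_mono1 nat_mult_1)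
    finally show "Y' \<le> q0" by (simp add: q0_def)
    have "1 + L * P \<le> L * P + L * P" using L0 P0 by (simp add: Suc_le_eq)
    also have "\<dots> = 2 * L * P" by simp
    also have "\<dots> \<le> 2 * L * (2 * D * Y) ^ D" using PY by (rule mult_le_mono2)
    finally show "q0 \<le> 2 * L * (2 * D * Y) ^ D" by (simp add: q0_def)
    show "Q > 0" by (rule Q0)
    show "u x < r q0 * (D * (2 * D * Y)^2 + 1) * (2 * R) ^ Suc D" for x
      unfolding card\<Gamma>[symmetric] u_def using h col\<Gamma>[of x] by (auto dest: bij_betwE)
    show "u (x + int Q) = u x" for x
      unfolding u_def col_def by (rule arg_cong[of _ _ h], rule residue_color_periodic) (use qQ in auto)
    show "Bad \<subseteq> {0..<int Q}" by (auto simp: Bad_def)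
    have "card Bad \<le> card {d\<in>{0..<int Q}. int q0 dvd d} + card {d\<in>{0..<int Q}. int P dvd d}"
      unfolding Bad_def by (rule card_Un_le)
    then have "card Bad * Y' ^ D \<le> card {d\<in>{0..<int Q}. int q0 dvd d} * Y' ^ D + card {d\<in>{0..<int Q}. int P dvd d} * Y' ^ D"
      by (metis add_mult_distrib mult_le_mono1)
    also have "\<dots> \<le> card {d\<in>{0..<int Q}. int q0 dvd d} * q0 + card {d\<in>{0..<int Q}. int P dvd d} * P"
    proof (intro add_mono mult_le_mono2)
      have "Y' ^ D \<le> Y ^ D" using Y1 by (intro power_mono) auto
      then show YP': "Y' ^ D \<le> P" using YP by linarith
      have "P \<le> L * P" using L0 by simp
      then show "Y' ^ D \<le> q0" using YP' unfolding q0_def by linarith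
    qed
    also have "\<dots> = Q + Q"
    proof -
      have "q0 dvd Q" "P dvd Q" by (simp_all add: Q_def)
      moreover have "q0 > 0" by (simp add: q0_def)
      ultimately show ?thesis using P0 by (simp only: card_multiples)
    qed
    also have "\<dots> = 2 * Q" by simp
    finally show "card Bad * Y' ^ D \<le> 2 * Q" .
    fix n d assume rel: "\<forall>\<phi> :: nat \<Rightarrow> int. (\<Sum>i<k. cf i * \<phi> (u (n + a ! i * d))) = 0"
    have "int (q 0) dvd d \<or> (\<forall>j\<in>{1..D}. int (q j) dvd d)"
    proof (rule residue_color_relation[OF a sym k cf, where L = "int L" and R = "int R" and W = "int W" and c = c and n = n])
      show "(a ! i - a ! j) dvd int L" if "i < k" "j < k" "i \<noteq> j" for i j
      proof -
        have "a ! i \<noteq> a ! j" using that a k(1) by (metis less_irrefl linorder_neqE_nat sorted_wrt_nth_less)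
        then have "nat \<bar>a ! i - a ! j\<bar> dvd fact W" using W[OF that(1,2)] by (intro dvd_fact) auto
        then show ?thesis unfolding L_def by (simp add: nat_abs_dvd_iff)
      qed
      show "int R \<ge> 2 * int W * int L" by (simp add: R_def)
      show "\<not> sym_colored_AP a c (nat (int (q 0))) n d" for n d using c(2) by (simp add: q_def)
      show "(\<Sum>i<k. cf i * \<phi> (residue_color (\<lambda>j. int (q j)) D (int L) (int R) c (n + a ! i * d))) = 0" for \<phi>
      proof -
        have "\<phi> (col x) = \<phi> (inv_into \<Gamma> h (u x))" for x
          using bij_betw_inv_into_left[OF h col\<Gamma>[of x]] by (simp add: u_def)
        then show ?thesis using rel[rule_format, of "\<lambda>v. \<phi> (inv_into \<Gamma> h v)"] by (simp add: col_def)
      qed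
      show "coprime (int (q j)) (int L)" for j using copL[of j] by (simp add: coprime_int_iff)
    qed (use qpos R0 L0 W in auto)
    moreover have "int P dvd d" if "\<forall>j\<in>{1..D}. int (q j) dvd d"
      unfolding Pq of_nat_prod using that cop by (intro prod_dvd_of_coprime) (auto simp: coprime_int_iff)
    ultimately have "int q0 dvd d \<or> int P dvd d" by (auto simp: q_def)
    moreover have "int q0 dvd int Q" "int P dvd int Q" by (simp_all add: Q_def)
    moreover have "int Q > 0" using Q0 by simp
    ultimately show "d mod int Q \<in> Bad" by (auto simp: Bad_def dvd_mod)
  qed
qed

text \<open>\<open>M\<close> has order \<open>G ^ k\<close>, so \<open>T\<close>, of order
  \<open>(G * M) ^ k\<close>, has order \<open>G ^ (k * (k + 1))\<close>; the added ones are
  absorbed by doubling.\<close>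

lemma moment_encoding_size:
  fixes Cs G M k T :: nat
  assumes "Cs \<ge> 1" "G \<ge> 1" "k \<ge> 1"
    and M: "M = Cs * G ^ k + 1" and T: "T = Cs * k * (G * M) ^ k + 1"
  shows "T * Cs \<le> (2 * Cs * k * (2 * Cs) ^ k * Cs) * G ^ (k * (k + 1))"
proof -
  have "1 \<le> Cs * G ^ k" using assms by (simp add: Suc_le_eq)
  then have "M \<le> 2 * Cs * G ^ k" unfolding M by linarith
  then have "G * M \<le> G * (2 * Cs * G ^ k)" by (rule mult_le_mono2)
  also have "\<dots> = 2 * Cs * G ^ (k + 1)" by simp
  finally have "(G * M) ^ k \<le> (2 * Cs * G ^ (k + 1)) ^ k" by (rule power_mono) simp
  also have "\<dots> = (2 * Cs) ^ k * G ^ (k * (k + 1))"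
    by (simp only: power_mult_distrib power_mult[symmetric] mult.commute[of "k + 1"])
  finally have GM: "(G * M) ^ k \<le> (2 * Cs) ^ k * G ^ (k * (k + 1))" .
  have "1 \<le> Cs * k * (G * M) ^ k" using assms by (simp add: Suc_le_eq)
  then have "T \<le> 2 * Cs * k * (G * M) ^ k" unfolding T by linarith
  also have "\<dots> \<le> 2 * Cs * k * ((2 * Cs) ^ k * G ^ (k * (k + 1)))" using GM by (rule mult_le_mono2)
  finally have "T * Cs \<le> 2 * Cs * k * ((2 * Cs) ^ k * G ^ (k * (k + 1))) * Cs" by (rule mult_le_mono1)
  then show ?thesis by (simp add: mult_ac)
qed

text \<open>The exponent of \<open>Y'\<close> in the bound for \<open>T\<close> does not depend on
  \<open>D\<close>, while the density of \<open>Bad\<close> decays like \<open>1 / Y' ^ D\<close>.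
  This is possible because \<open>r q0 ^ D \<le> q0\<close> makes \<open>r q0\<close> at most linear
  in \<open>Y'\<close>.\<close>

lemma coloring_of_polynomial_size:
  fixes a :: "int list" and cf :: "nat \<Rightarrow> int" and r :: "nat \<Rightarrow> nat" and D N1 :: nat
  assumes a: "sorted_wrt (<) a" and sym: "symmetric_tuple a" and k: "k = length a" "k \<ge> 2"
    and cf: "\<And>i. i < k \<Longrightarrow> cf i \<noteq> 0" "(\<Sum>i<k. cf i) = 0"
      "\<And>m. 0 < m \<Longrightarrow> m < k \<Longrightarrow> (\<Sum>i\<in>{m..<k}. cf i) \<noteq> 0"
    and r: "\<And>N. N \<ge> 1 \<Longrightarrow> \<exists>c. c ` {1..int N} \<subseteq> {..<r N} \<and> \<not> (\<exists>n d. sym_colored_AP a c N n d)"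
    and rD: "\<And>N. N \<ge> N1 \<Longrightarrow> r N ^ D \<le> N" and D: "D \<ge> 1"
  shows "\<exists>K8 :: nat. \<forall>Y' \<ge> max 1 N1. \<exists>(Q::nat) (T::nat) (g :: int \<Rightarrow> nat) Bad.
    Q > 0 \<and> (\<forall>x. g x < T) \<and> (\<forall>x. g (x + int Q) = g x) \<and>
    real T * real_of_int (\<Sum>i<k. \<bar>cf i\<bar>) \<le> real K8 * real Y' ^ (3 * (k * (k + 1))) \<and>
    Bad \<subseteq> {0..<int Q} \<and> card Bad * Y' ^ D \<le> 2 * Q \<and>
    (\<forall>n d. int T dvd (\<Sum>i<k. cf i * int (g (n + a ! i * d))) \<longrightarrow> d mod int Q \<in> Bad)"
proof -
  define Cs where "Cs = nat (\<Sum>i<k. \<bar>cf i\<bar>)"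
  have Cs: "int Cs = (\<Sum>i<k. \<bar>cf i\<bar>)" unfolding Cs_def by (simp add: sum_nonneg)
  have "\<bar>cf 0\<bar> \<le> (\<Sum>i<k. \<bar>cf i\<bar>)" using k by (intro member_le_sum) auto
  then have Cs1: "Cs \<ge> 1" using Cs cf(1)[of 0] k by linarith
  define W where "W = nat (a ! (k - 1) - a ! 0)"
  have le: "a ! i \<le> a ! j" if "i \<le> j" "j < k" for i j
    using a that k(1) by (cases "i = j") (auto simp: sorted_wrt_nth_less less_imp_le)
  have W: "\<bar>a ! i - a ! j\<bar> \<le> int W" if "i < k" "j < k" for i j
    using le[of 0 i] le[of 0 j] le[of i "k - 1"] le[of j "k - 1"] that unfolding W_def by linarith
  define L where "L = (fact W :: nat)"
  define R where "R = 2 * W * L + 1"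
  define F where "F = fact D * L"
  have L1: "L \<ge> 1" by (simp add: L_def fact_ge_1)
  then have F1: "F \<ge> 1" by (simp add: F_def Suc_le_eq)
  define K6 where "K6 = 4 * L * D * F * (D * (2 * D * F)^2 + 1) * (2 * R) ^ Suc D"
  define K8 where "K8 = (2 * Cs * k * (2 * Cs) ^ k * Cs) * K6 ^ (k * (k + 1))"
  have K6: "K6 \<ge> 1" using L1 F1 D by (simp add: K6_def Suc_le_eq R_def)
  show ?thesis
  proof (rule exI[of _ K8], intro allI impI)
    fix Y' assume Y': "max 1 N1 \<le> Y'"
    then have Y1: "Y' \<ge> 1" by simp
    define Y where "Y = F * Y'"
    obtain q0 Q and u :: "int \<Rightarrow> nat" and Bad where q0: "Y' \<le> q0" "q0 \<le> 2 * L * (2 * D * Y) ^ D"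
      and Q: "Q > 0" and u: "\<And>x. u x < r q0 * (D * (2 * D * Y)^2 + 1) * (2 * R) ^ Suc D"
      and per: "\<And>x. u (x + int Q) = u x"
      and Bad: "Bad \<subseteq> {0..<int Q}" "card Bad * Y' ^ D \<le> 2 * Q"
      and bad: "\<And>n d. (\<forall>\<phi> :: nat \<Rightarrow> int. (\<Sum>i<k. cf i * \<phi> (u (n + a ! i * d))) = 0) \<Longrightarrow> d mod int Q \<in> Bad"
      using coloring_at_scale[OF a sym k cf r W D Y1]
      unfolding L_def[symmetric] R_def[symmetric] F_def[symmetric] Y_def[symmetric] by blast
    \<comment> \<open>One factor \<open>Y'\<close> comes from \<open>r q0\<close>, two come from the
      range of the norm.\<close>
    define G where "G = K6 * Y' ^ 3"
    have G1: "G \<ge> 1" using K6 Y1 by (simp add: G_def Suc_le_eq)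
    have "r q0 ^ D \<le> 2 * L * (2 * D * Y) ^ D" using rD[of q0] q0 Y' by linarith
    also have "\<dots> \<le> (2 * L) ^ D * (2 * D * Y) ^ D"
      using L1 D by (intro mult_le_mono1 self_le_power) auto
    also have "\<dots> = (4 * L * D * Y) ^ D" by (simp only: power_mult_distrib[symmetric]) (simp add: mult_ac)
    finally have rqD: "r q0 ^ D \<le> (4 * L * D * Y) ^ D" .
    have rq: "r q0 \<le> 4 * L * D * Y"
    proof (rule ccontr)
      assume "\<not> ?thesis"
      then have "(4 * L * D * Y) ^ D < r q0 ^ D" using D by (intro power_strict_mono) auto
      then show False using rqD by linarith
    qed
    have uG: "u x < G" for x
    proof -
      have "D * (2 * D * Y)^2 + 1 \<le> D * (2 * D * Y)^2 + Y' ^ 2" using Y1 by simp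
      also have "\<dots> = (D * (2 * D * F)^2 + 1) * Y' ^ 2"
        by (simp add: Y_def power2_eq_square algebra_simps)
      finally have "r q0 * (D * (2 * D * Y)^2 + 1) * (2 * R) ^ Suc D \<le>
          (4 * L * D * Y) * ((D * (2 * D * F)^2 + 1) * Y' ^ 2) * (2 * R) ^ Suc D"
        using rq by (intro mult_le_mono1 mult_le_mono)
      also have "\<dots> = G"
      proof -
        have "(4 * L * D * (F * Y')) * (U * Y' ^ 2) * V = (4 * L * D * F * U * V) * Y' ^ 3" for U V
          by (simp add: power2_eq_square power3_eq_cube mult_ac)
        then show ?thesis unfolding G_def K6_def Y_def .
      qed
      finally show ?thesis using u[of x] by linarith
    qed
    \<comment> \<open>\<open>M\<close> exceeds every weighted moment, so digits in base
      \<open>M\<close> do not interact; \<open>T\<close> exceeds every value of the weighted sum of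
      \<open>g\<close>, so divisibility by \<open>T\<close> forces that sum to vanish.\<close>
    define M where "M = Cs * G ^ k + 1"
    define T where "T = Cs * k * (G * M) ^ k + 1"
    define g where "g x = (\<Sum>j<k. u x ^ j * M ^ j)" for x
    have gb: "g x \<le> k * (G * M) ^ k" for x
    proof -
      have "g x \<le> (\<Sum>j<k. (G * M) ^ k)" unfolding g_def
      proof (rule sum_mono)
        fix j assume j: "j \<in> {..<k}"
        have "u x ^ j * M ^ j = (u x * M) ^ j" by (simp add: power_mult_distrib)
        also have "\<dots> \<le> (G * M) ^ j" using uG[of x] by (intro power_mono mult_le_mono1) auto
        also have "\<dots> \<le> (G * M) ^ k" using j G1 by (intro power_increasing) (auto simp: M_def Suc_le_eq)
        finally show "u x ^ j * M ^ j \<le> (G * M) ^ k" .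
      qed
      then show ?thesis by simp
    qed
    have gT: "g x < T" for x
    proof -
      have "k * (G * M) ^ k \<le> Cs * (k * (G * M) ^ k)" using Cs1 by simp
      then show ?thesis using gb[of x] unfolding T_def mult.assoc by linarith
    qed
    have "T * Cs \<le> (2 * Cs * k * (2 * Cs) ^ k * Cs) * G ^ (k * (k + 1))"
      using Cs1 G1 k M_def T_def by (intro moment_encoding_size) auto
    also have "\<dots> = K8 * Y' ^ (3 * (k * (k + 1)))"
      by (simp only: G_def K8_def power_mult_distrib power_mult mult.assoc)
    finally have size: "T * Cs \<le> K8 * Y' ^ (3 * (k * (k + 1)))" .
    have final: "d mod int Q \<in> Bad" if dvd: "int T dvd (\<Sum>i<k. cf i * int (g (n + a ! i * d)))" for n d
    proof (rule bad, intro allI)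
      fix \<phi> :: "nat \<Rightarrow> int"
      have "\<bar>\<Sum>i<k. cf i * int (g (n + a ! i * d))\<bar> \<le> (\<Sum>i<k. \<bar>cf i\<bar> * int (k * (G * M) ^ k))"
      proof (intro order_trans[OF sum_abs] sum_mono)
        fix i
        have "int (g (n + a ! i * d)) \<le> int (k * (G * M) ^ k)" using gb by (simp only: of_nat_le_iff)
        then show "\<bar>cf i * int (g (n + a ! i * d))\<bar> \<le> \<bar>cf i\<bar> * int (k * (G * M) ^ k)"
          unfolding abs_mult by (intro mult_left_mono) auto
      qed
      also have "\<dots> = int Cs * int (k * (G * M) ^ k)" by (simp only: Cs sum_distrib_right)
      also have "\<dots> < int T" by (simp add: T_def mult.assoc)
      finally have "\<bar>\<Sum>i<k. cf i * int (g (n + a ! i * d))\<bar> < int T" .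
      then have "(\<Sum>i<k. cf i * int (g (n + a ! i * d))) = 0"
        using dvd dvd_imp_le_int[of "\<Sum>i<k. cf i * int (g (n + a ! i * d))" "int T"] by fastforce
      then have rel: "(\<Sum>i<k. cf i * (\<Sum>j<k. int (u (n + a ! i * d)) ^ j * int M ^ j)) = 0"
        by (simp add: g_def)
      show "(\<Sum>i<k. cf i * \<phi> (u (n + a ! i * d))) = 0"
      proof (rule moment_encoding[OF _ uG rel])
        show "(\<Sum>i<k. \<bar>cf i\<bar>) * int G ^ k < int M" by (simp add: M_def Cs[symmetric])
      qed
    qed
    show "\<exists>(Q::nat) (T::nat) (g :: int \<Rightarrow> nat) Bad.
      Q > 0 \<and> (\<forall>x. g x < T) \<and> (\<forall>x. g (x + int Q) = g x) \<and>
      real T * real_of_int (\<Sum>i<k. \<bar>cf i\<bar>) \<le> real K8 * real Y' ^ (3 * (k * (k + 1))) \<and>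
      Bad \<subseteq> {0..<int Q} \<and> card Bad * Y' ^ D \<le> 2 * Q \<and>
      (\<forall>n d. int T dvd (\<Sum>i<k. cf i * int (g (n + a ! i * d))) \<longrightarrow> d mod int Q \<in> Bad)"
    proof (rule exI[of _ Q], rule exI[of _ T], rule exI[of _ g], rule exI[of _ Bad], intro conjI allI impI)
      show "real T * real_of_int (\<Sum>i<k. \<bar>cf i\<bar>) \<le> real K8 * real Y' ^ (3 * (k * (k + 1)))"
        unfolding Cs[symmetric] of_int_of_nat_eq using size
        by (simp only: of_nat_mult[symmetric] of_nat_power[symmetric] of_nat_le_iff)
    qed (use Q gT per Bad final in \<open>auto simp: g_def\<close>)
  qed
qed

section \<open>Choice of parameters in terms of \<open>\<alpha>\<close>\<close>

lemma subpolynomial_colors: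
  fixes r :: "nat \<Rightarrow> nat"
  assumes "\<And>N. N \<ge> 1 \<Longrightarrow> r N \<ge> 1" "(\<lambda>N. ln (real (r N)) / ln (real N)) \<longlonglongrightarrow> 0" "D \<ge> 1"
  shows "\<exists>N1. \<forall>N\<ge>N1. r N ^ D \<le> N"
proof -
  have "\<forall>\<^sub>F N in sequentially. ln (real (r N)) / ln (real N) < 1 / real D"
    using assms(2,3) by (intro order_tendstoD(2)[where y = 0]) auto
  then obtain N2 where N2: "\<And>N. N \<ge> N2 \<Longrightarrow> ln (real (r N)) / ln (real N) < 1 / real D"
    by (auto simp: eventually_sequentially)
  \<comment> \<open>From \<open>2\<close> on, \<open>ln N\<close> is positive and the denominator
    may be cleared.\<close>
  have "r N ^ D \<le> N" if "N \<ge> max 2 N2" for N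
  proof -
    have N: "N \<ge> 2" "N \<ge> N2" using that by auto
    have r1: "r N \<ge> 1" using assms(1)[of N] N by simp
    have "ln (real (r N)) < ln (real N) / real D"
      using N2[OF N(2)] N(1) assms(3) by (simp add: field_simps)
    then have "ln (real (r N) ^ D) < ln (real N)"
      using assms(3) r1 by (simp add: ln_realpow field_simps)
    then have "real (r N) ^ D < real N" using r1 N by simp
    then show ?thesis by (simp only: of_nat_power[symmetric] of_nat_less_iff)
  qed
  then show ?thesis by blast
qed

text \<open>With \<open>Y'\<close> about \<open>\<alpha> powr (- e)\<close> and
  \<open>e = (C + 1) / D\<close>, \<open>Bad\<close> has density at most
  \<open>2 * \<alpha> powr (C + 1)\<close>, while \<open>T\<close> is at most a constant times
  \<open>\<alpha> powr (- 1 / 2)\<close>, so \<open>\<alpha> * T\<close> tends to zero.\<close>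

lemma coloring_parameters:
  fixes a :: "int list" and cf :: "nat \<Rightarrow> int" and r :: "nat \<Rightarrow> nat" and C :: real
  assumes a: "sorted_wrt (<) a" and sym: "symmetric_tuple a" and k: "k = length a" "k \<ge> 2"
    and cf: "\<And>i. i < k \<Longrightarrow> cf i \<noteq> 0" "(\<Sum>i<k. cf i) = 0"
      "\<And>m. 0 < m \<Longrightarrow> m < k \<Longrightarrow> (\<Sum>i\<in>{m..<k}. cf i) \<noteq> 0"
    and r: "\<And>N. N \<ge> 1 \<Longrightarrow> \<exists>c. c ` {1..int N} \<subseteq> {..<r N} \<and> \<not> (\<exists>n d. sym_colored_AP a c N n d)"
    and r1: "\<And>N. N \<ge> 1 \<Longrightarrow> r N \<ge> 1" "(\<lambda>N. ln (real (r N)) / ln (real N)) \<longlonglongrightarrow> 0" and C: "C > 0"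
  shows "\<forall>\<^sub>F \<alpha> in at_right 0. \<exists>(Q::nat) (T::nat) (g :: int \<Rightarrow> nat) Bad.
    Q > 0 \<and> (\<forall>x. g x < T) \<and> (\<forall>x. g (x + int Q) = g x) \<and>
    \<alpha> * real T * real_of_int (\<Sum>i<k. \<bar>cf i\<bar>) < 1 \<and>
    Bad \<subseteq> {0..<int Q} \<and> real (card Bad) / real Q \<le> \<alpha> powr C / 2 \<and>
    (\<forall>n d. int T dvd (\<Sum>i<k. cf i * int (g (n + a ! i * d))) \<longrightarrow> d mod int Q \<in> Bad)"
proof -
  define K where "K = k * (k + 1)"
  \<comment> \<open>Large enough for \<open>3 * K * e \<le> 1 / 2\<close>, where
    \<open>3 * K\<close> is the exponent of \<open>Y'\<close> in the bound for
    \<open>T\<close>.\<close>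
  define D where "D = nat \<lceil>6 * real K * (C + 1)\<rceil>"
  have D6: "real D \<ge> 6 * real K * (C + 1)" unfolding D_def by (rule real_nat_ceiling_ge)
  have "0 < k" using k(2) by simp
  then have "K > 0" unfolding K_def by simp
  then have "6 * real K * (C + 1) > 0" using C by simp
  then have D1: "D \<ge> 1" using D6 by linarith
  obtain N1 where N1: "\<And>N. N \<ge> N1 \<Longrightarrow> r N ^ D \<le> N"
    using subpolynomial_colors[OF r1 D1] by blast
  obtain K8 :: nat where K8: "\<forall>Y' \<ge> max 1 N1. \<exists>(Q::nat) (T::nat) (g :: int \<Rightarrow> nat) Bad.
    Q > 0 \<and> (\<forall>x. g x < T) \<and> (\<forall>x. g (x + int Q) = g x) \<and>
    real T * real_of_int (\<Sum>i<k. \<bar>cf i\<bar>) \<le> real K8 * real Y' ^ (3 * K) \<and>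
    Bad \<subseteq> {0..<int Q} \<and> card Bad * Y' ^ D \<le> 2 * Q \<and>
    (\<forall>n d. int T dvd (\<Sum>i<k. cf i * int (g (n + a ! i * d))) \<longrightarrow> d mod int Q \<in> Bad)"
    using coloring_of_polynomial_size[OF a sym k cf r N1 D1] unfolding K_def by (rule exE)
  define e where "e = (C + 1) / real D"
  have e0: "e > 0" using C D1 by (simp add: e_def)
  have "\<forall>\<^sub>F \<alpha>::real in at_right 0. \<alpha> > 0" by (rule eventually_at_right_less)
  moreover have "\<forall>\<^sub>F \<alpha>::real in at_right 0. \<alpha> < 1 / 4" by real_asymp
  moreover have "\<forall>\<^sub>F \<alpha>::real in at_right 0. \<alpha> powr (- e) > real (max 1 N1)" using e0 by real_asymp
  moreover have "\<forall>\<^sub>F \<alpha>::real in at_right 0. (real K8 * 2 ^ (3 * K)) * \<alpha> powr (1 / 2) < 1" by real_asymp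
  ultimately show ?thesis
  proof eventually_elim
    case (elim \<alpha>)
    define x where "x = \<alpha> powr (- e)"
    define Y' where "Y' = nat \<lceil>x\<rceil>"
    have x1: "x \<ge> 1" using elim by (simp add: x_def)
    have Yx: "real Y' \<ge> x" unfolding Y'_def by (rule real_nat_ceiling_ge)
    have Yx2: "real Y' \<le> 2 * x" unfolding Y'_def using x1 by linarith
    have "Y' \<ge> max 1 N1" using elim Yx by (simp add: x_def)
    from K8[THEN spec, THEN mp, OF this] obtain Q T :: nat and g :: "int \<Rightarrow> nat" and Bad where
      Q: "Q > 0" and g: "\<forall>x. g x < T" "\<forall>x. g (x + int Q) = g x" and
      T: "real T * real_of_int (\<Sum>i<k. \<bar>cf i\<bar>) \<le> real K8 * real Y' ^ (3 * K)" and
      Bad: "Bad \<subseteq> {0..<int Q}" "card Bad * Y' ^ D \<le> 2 * Q" and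
      bad: "\<forall>n d. int T dvd (\<Sum>i<k. cf i * int (g (n + a ! i * d))) \<longrightarrow> d mod int Q \<in> Bad" by blast
    have "\<alpha> * real T * real_of_int (\<Sum>i<k. \<bar>cf i\<bar>) \<le> \<alpha> * (real K8 * real Y' ^ (3 * K))"
      using T elim by (simp only: mult.assoc) (intro mult_left_mono, auto)
    also have "\<dots> \<le> \<alpha> * (real K8 * (2 * x) ^ (3 * K))"
      using Yx2 elim by (intro mult_left_mono power_mono) auto
    also have "\<dots> = real K8 * 2 ^ (3 * K) * (\<alpha> * x ^ (3 * K))" by (simp add: power_mult_distrib)
    also have "\<alpha> * x ^ (3 * K) = \<alpha> powr (1 - e * (3 * K))"
      using elim by (simp add: x_def powr_power powr_diff powr_minus_divide field_simps powr_add[symmetric])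
    also have "\<dots> \<le> \<alpha> powr (1 / 2)"
    proof -
      have "e * (3 * K) \<le> 1 / 2" using D6 D1 by (simp add: e_def field_simps)
      then show ?thesis using elim by (intro powr_mono') auto
    qed
    also have "real K8 * 2 ^ (3 * K) * \<alpha> powr (1 / 2) < 1" using elim by simp
    finally have 1: "\<alpha> * real T * real_of_int (\<Sum>i<k. \<bar>cf i\<bar>) < 1" by (simp add: mult_left_mono)
    have xD: "x ^ D = \<alpha> powr (- (C + 1))"
      using D1 elim by (simp add: x_def powr_power e_def)
    have "real (card Bad) * x ^ D \<le> real (card Bad) * real Y' ^ D"
      using Yx x1 by (intro mult_left_mono power_mono) auto
    also have "\<dots> \<le> 2 * real Q"
    proof -
      have "real (card Bad * Y' ^ D) \<le> real (2 * Q)" using Bad(2) by (simp only: of_nat_le_iff)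
      then show ?thesis by simp
    qed
    finally have "real (card Bad) / real Q \<le> 2 * \<alpha> powr (C + 1)"
      using Q elim unfolding xD powr_minus_divide by (simp add: field_simps)
    also have "\<alpha> powr (C + 1) = \<alpha> powr C * \<alpha>" using elim by (simp add: powr_add)
    \<comment> \<open>\<open>\<alpha> < 1 / 4\<close> turns the spare factor
      \<open>2 * \<alpha>\<close> into \<open>1 / 2\<close>, which later gives the strict
      inequality.\<close>
    also have "2 * (\<alpha> powr C * \<alpha>) \<le> 2 * (\<alpha> powr C * (1 / 4))"
      using elim by (intro mult_left_mono) auto
    finally have 2: "real (card Bad) / real Q \<le> \<alpha> powr C / 2" by simp
    show ?case using Q g 1 Bad(1) 2 bad by blast
  qed
qed

subsection \<open>Counting progressions and conclusion\<close>

text \<open>In units of \<open>p / T\<close>, each \<open>z i\<close> exceeds \<open>g i\<close> by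
  less than \<open>\<alpha> * T\<close>. The weighted sum of these offsets is an integer of absolute
  value below 1, hence zero.\<close>

lemma interval_relation:
  fixes cf :: "nat \<Rightarrow> int" and z :: "nat \<Rightarrow> int" and g :: "nat \<Rightarrow> nat" and p T :: nat
  assumes pT: "p > 0" "T > 0" and small: "\<alpha> * real T * real_of_int (\<Sum>i<k. \<bar>cf i\<bar>) < 1"
    and z: "\<And>i. i < k \<Longrightarrow> real (g i) * real p / real T \<le> of_int (z i)"
      "\<And>i. i < k \<Longrightarrow> of_int (z i) < real (g i) * real p / real T + \<alpha> * real p"
    and rel: "int p dvd (\<Sum>i<k. cf i * z i)"
  shows "int T dvd (\<Sum>i<k. cf i * int (g i))"
proof -
  obtain m where m: "(\<Sum>i<k. cf i * z i) = int p * m" using rel by blast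
  define \<theta> where "\<theta> i = real_of_int (z i) * real T / real p - real (g i)" for i
  have \<theta>: "\<bar>\<theta> i\<bar> \<le> \<alpha> * real T" if "i < k" for i
    using z[OF that] pT by (auto simp: \<theta>_def field_simps)
  have "(\<Sum>i<k. real_of_int (cf i) * \<theta> i) =
      real_of_int (\<Sum>i<k. cf i * z i) * real T / real p - real_of_int (\<Sum>i<k. cf i * int (g i))"
    by (simp add: \<theta>_def sum_subtractf right_diff_distrib sum_distrib_right sum_divide_distrib mult.assoc)
  also have "\<dots> = real_of_int (m * int T - (\<Sum>i<k. cf i * int (g i)))"
    using pT by (simp add: m)
  finally have eq: "(\<Sum>i<k. real_of_int (cf i) * \<theta> i) = real_of_int (m * int T - (\<Sum>i<k. cf i * int (g i)))" .
  have "\<bar>\<Sum>i<k. real_of_int (cf i) * \<theta> i\<bar> \<le> (\<Sum>i<k. \<bar>real_of_int (cf i)\<bar> * (\<alpha> * real T))"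
    using \<theta> by (intro order_trans[OF sum_abs] sum_mono) (auto simp: abs_mult intro!: mult_left_mono)
  also have "\<dots> = \<alpha> * real T * real_of_int (\<Sum>i<k. \<bar>cf i\<bar>)"
    by (simp add: sum_distrib_left mult_ac)
  finally have "\<bar>real_of_int (m * int T - (\<Sum>i<k. cf i * int (g i)))\<bar> < 1"
    unfolding eq using small by linarith
  then have "m * int T - (\<Sum>i<k. cf i * int (g i)) = 0" by linarith
  then show ?thesis by (metis dvd_triv_right eq_iff_diff_eq_0)
qed

lemma AP_count_Re:
  assumes "N > 0"
  shows "Re (AP_count (integer_mod_group N) a (indicator A)) =
    (\<Sum>n\<in>{0..<int N}. \<Sum>d\<in>{0..<int N}. if \<forall>i<length a. (n + a ! i * d) mod int N \<in> A then 1 else 0) / real N ^ 2"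
proof -
  have "(\<Prod>i<length a. indicator A (n \<otimes>\<^bsub>integer_mod_group N\<^esub> d [^]\<^bsub>integer_mod_group N\<^esub> (a ! i)) :: complex)
      = of_real (if \<forall>i<length a. (n + a ! i * d) mod int N \<in> A then 1 else 0)" for n d
  proof -
    have "n \<otimes>\<^bsub>integer_mod_group N\<^esub> d [^]\<^bsub>integer_mod_group N\<^esub> (a ! i) = (n + a ! i * d) mod int N" for i
      by (simp add: int_pow_integer_mod_group mod_add_right_eq)
    then show ?thesis by (auto simp: indicator_def prod_zero_iff)
  qed
  then have "AP_count (integer_mod_group N) a (indicator A) = of_real
    ((\<Sum>n\<in>{0..<int N}. \<Sum>d\<in>{0..<int N}. if \<forall>i<length a. (n + a ! i * d) mod int N \<in> A then 1 else 0) / real N ^ 2)"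
    using assms unfolding AP_count_def by (simp add: carrier_integer_mod_group)
  then show ?thesis by (simp only: Re_complex_of_real)
qed

text \<open>The power \<open>x ^ (k - 2)\<close> makes the set uniform, while the exact relation
  among these powers passes, through \<open>interval_relation\<close>, to a congruence for
  \<open>g\<close> that confines \<open>d mod Q\<close> to \<open>Bad\<close>.\<close>

lemma uniform_set_with_few_APs:
  fixes a :: "int list" and cf :: "nat \<Rightarrow> int" and g :: "int \<Rightarrow> nat"
  assumes k: "k = length a" "k \<ge> 3"
    and cf: "\<And>n d. (\<Sum>i<k. cf i * (n + a ! i * d) ^ (k - 2)) = 0" "\<exists>i<k. cf i \<noteq> 0"
    and Q: "Q > 0" and g: "\<And>x. g x < T" "\<And>x. g (x + int Q) = g x"
    and small: "\<alpha> * real T * real_of_int (\<Sum>i<k. \<bar>cf i\<bar>) < 1" and \<alpha>: "\<alpha> > 0"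
    and Bad: "Bad \<subseteq> {0..<int Q}"
      "\<And>n d. int T dvd (\<Sum>i<k. cf i * int (g (n + a ! i * d))) \<Longrightarrow> d mod int Q \<in> Bad"
    and \<eta>: "\<eta> > 0"
  shows "\<exists>N\<ge>N0. \<exists>A\<subseteq>carrier (integer_mod_group N).
    gowers_norm (integer_mod_group N) (k - 2) (\<lambda>x. indicator A x - complex_of_real \<alpha>) \<le> \<eta> \<and>
    Re (AP_count (integer_mod_group N) a (indicator A)) \<le> real (card Bad) / real Q"
proof -
  define s where "s = k - 2"
  have s1: "s \<ge> 1" using k by (simp add: s_def)
  define \<epsilon> where "\<epsilon> = (1 / 2 ^ s :: real)"
  have e0: "\<epsilon> > 0" by (simp add: \<epsilon>_def)
  have "(\<lambda>p. 1 / real p + (4 * real p powr (- \<epsilon>) + 4 * (ln (real p) / real p powr \<epsilon>))) \<longlonglongrightarrow> 0 + (4 * 0 + 4 * 0)"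
    using e0 by (intro tendsto_intros lim_1_over_n lim_ln_over_power tendsto_neg_powr filterlim_real_sequentially) auto
  then have "(\<lambda>p. 1 / real p + 4 * (1 + ln (real p)) * real p powr (- \<epsilon>)) \<longlonglongrightarrow> 0"
    by (simp add: powr_minus_divide algebra_simps)
  then have "\<forall>\<^sub>F p in sequentially. 1 / real p + 4 * (1 + ln (real p)) * real p powr (- \<epsilon>) < \<eta> ^ (2 ^ s)"
    using \<eta> by (intro order_tendstoD(2)) auto
  then obtain P0 where P0: "\<And>p. p \<ge> P0 \<Longrightarrow>
      1 / real p + 4 * (1 + ln (real p)) * real p powr (- \<epsilon>) < \<eta> ^ (2 ^ s)"
    by (auto simp: eventually_sequentially)
  \<comment> \<open>\<open>p\<close> beats \<open>\<eta>\<close> through \<open>P0\<close>, exceeds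
    \<open>N0\<close> and \<open>s\<close>, and is coprime to \<open>Q\<close> as a larger
    prime.\<close>
  obtain p where p: "prime p" "p > P0 + N0 + Q + s" using bigger_prime by blast
  have p0: "p > 0" using p(1) prime_gt_0_nat by blast
  have cop: "coprime p Q"
    using p Q by (intro prime_imp_coprime) (auto dest: dvd_imp_le)
  define N where "N = Q * p"
  have N0: "N > 0" using Q p0 by (simp add: N_def)
  have T0: "T > 0" using g(1)[of 0] by simp
  have \<alpha>T: "\<alpha> * real T < 1"
  proof -
    obtain i where "i < k" "cf i \<noteq> 0" using cf(2) by blast
    then have "\<bar>cf i\<bar> \<le> (\<Sum>i<k. \<bar>cf i\<bar>)" "\<bar>cf i\<bar> \<ge> 1" by (auto intro: member_le_sum)
    then have "1 \<le> real_of_int (\<Sum>i<k. \<bar>cf i\<bar>)" by linarith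
    then have "\<alpha> * real T * 1 \<le> \<alpha> * real T * real_of_int (\<Sum>i<k. \<bar>cf i\<bar>)"
      using \<alpha> by (intro mult_left_mono) auto
    then show ?thesis using small by linarith
  qed
  have \<alpha>1: "\<alpha> \<le> 1"
  proof -
    have "\<alpha> * 1 \<le> \<alpha> * real T" using \<alpha> T0 by (intro mult_left_mono) auto
    then show ?thesis using \<alpha>T by linarith
  qed
  define b where "b x = real (g x) * real p / real T" for x
  define l where "l x = \<lceil>b x\<rceil>" for x
  \<comment> \<open>The number of integers in \<open>{b x..<b x + \<alpha> * p}\<close>; the
    interval is half-open, hence a ceiling at both ends.\<close>
  define m where "m x = nat (\<lceil>b x + \<alpha> * real p\<rceil> - \<lceil>b x\<rceil>)" for x
  have b0: "b x \<ge> 0" for x by (simp add: b_def)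
  \<comment> \<open>The interval does not wrap around modulo \<open>p\<close>, since
    \<open>g x \<le> T - 1\<close> and \<open>\<alpha> * T < 1\<close>.\<close>
  have bp: "b x + \<alpha> * real p \<le> real p" for x
  proof -
    have "real (g x) + \<alpha> * real T \<le> real T" using g(1)[of x] \<alpha>T by linarith
    then have "(real (g x) + \<alpha> * real T) * real p \<le> real T * real p" by (intro mult_right_mono) auto
    then show ?thesis using T0 by (simp add: b_def field_simps)
  qed
  have lm: "l x + int (m x) = \<lceil>b x + \<alpha> * real p\<rceil>" for x
    unfolding l_def m_def using \<alpha> by (simp add: ceiling_mono)
  have l: "0 \<le> l x" "l x + int (m x) \<le> int p" for x
  proof -
    show "0 \<le> l x" unfolding l_def using b0[of x] by linarith
    show "l x + int (m x) \<le> int p" unfolding lm using bp[of x] by (simp add: ceiling_le_iff)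
  qed
  have m: "\<bar>real (m x) / real p - \<alpha>\<bar> \<le> 1 / real p" for x
  proof -
    have "real (m x) = real_of_int \<lceil>b x + \<alpha> * real p\<rceil> - real_of_int \<lceil>b x\<rceil>"
      using lm[of x] by (simp add: l_def)
    then have "\<bar>real (m x) - \<alpha> * real p\<bar> \<le> 1" by linarith
    then have "\<bar>real (m x) - \<alpha> * real p\<bar> / real p \<le> 1 / real p" by (intro divide_right_mono) auto
    also have "\<bar>real (m x) - \<alpha> * real p\<bar> / real p = \<bar>(real (m x) - \<alpha> * real p) / real p\<bar>" by simp
    also have "(real (m x) - \<alpha> * real p) / real p = real (m x) / real p - \<alpha>"
      using p0 by (simp add: field_simps)
    finally show ?thesis .
  qed
  have per: "l (x + int Q) = l x" "m (x + int Q) = m x" for x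
    by (simp_all add: l_def m_def b_def g(2))
  define A where "A = {x \<in> {0..<int N}. x ^ s mod int p \<in> {l x..<l x + int (m x)}}"
  have "gowers_norm (integer_mod_group N) s (\<lambda>x. indicator A x - complex_of_real \<alpha>)
    \<le> root (2 ^ s) (1 / real p + 4 * (1 + ln (real p)) * real p powr (- 1 / 2 ^ s))"
    using p \<alpha> \<alpha>1
    by (intro gowers_norm_polynomial_interval[OF p(1) _ cop Q N_def s1 _ _ l m per A_def]) auto
  also have "\<dots> \<le> root (2 ^ s) (\<eta> ^ (2 ^ s))"
    using P0[of p] p(2) by (simp add: \<epsilon>_def)
  also have "\<dots> = \<eta>" using \<eta> by (simp add: real_root_power_cancel)
  finally have gow: "gowers_norm (integer_mod_group N) s (\<lambda>x. indicator A x - complex_of_real \<alpha>) \<le> \<eta>" .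
  have bad: "d mod int Q \<in> Bad" if mem: "\<forall>i<length a. (n + a ! i * d) mod int N \<in> A" for n d
  proof (rule Bad(2))
    define x where "x i = n + a ! i * d" for i
    have gx: "g (x i mod int N) = g (x i)" for i
    proof -
      have "x i mod int N + int Q * (int p * (x i div int N)) = x i"
        using mod_mult_div_eq[of "x i" "int N"] by (simp add: N_def mult.assoc)
      then show ?thesis
        using periodic_mult[where w = g and x = "x i mod int N" and t = "int p * (x i div int N)", OF g(2)]
        by (simp only:)
    qed
    have zx: "(x i mod int N) ^ s mod int p = x i ^ s mod int p" for i
    proof -
      have "(x i mod int N) mod int p = x i mod int p" by (rule mod_mod_cancel) (simp add: N_def)
      then show ?thesis by (metis power_mod)
    qed
    have z: "x i ^ s mod int p \<in> {\<lceil>b (x i)\<rceil>..<\<lceil>b (x i) + \<alpha> * real p\<rceil>}" if "i < k" for i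
    proof -
      have "x i mod int N \<in> A" using mem that k by (simp add: x_def)
      then have "(x i mod int N) ^ s mod int p \<in> {l (x i mod int N)..<l (x i mod int N) + int (m (x i mod int N))}"
        unfolding A_def by blast
      moreover have "b (x i mod int N) = b (x i)" by (simp only: b_def gx)
      ultimately show ?thesis unfolding lm zx by (simp only: l_def)
    qed
    have "int T dvd (\<Sum>i<k. cf i * int (g (x i)))"
    proof (rule interval_relation[OF p0 T0 small, where z = "\<lambda>i. x i ^ s mod int p"])
      show "real (g (x i)) * real p / real T \<le> real_of_int (x i ^ s mod int p)" if "i < k" for i
        using z[OF that] unfolding b_def by (auto simp: ceiling_le_iff)
      show "real_of_int (x i ^ s mod int p) < real (g (x i)) * real p / real T + \<alpha> * real p" if "i < k" for i
        using z[OF that] unfolding b_def by (auto simp: less_ceiling_iff)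
      \<comment> \<open>Reducing each power modulo \<open>p\<close> alters the exact relation only
        by a multiple of \<open>p\<close>.\<close>
      have "(\<Sum>i<k. cf i * (x i ^ s mod int p)) = (\<Sum>i<k. cf i * x i ^ s - int p * (cf i * (x i ^ s div int p)))"
        by (intro sum.cong refl) (simp add: minus_mult_div_eq_mod[symmetric] right_diff_distrib)
      also have "\<dots> = - int p * (\<Sum>i<k. cf i * (x i ^ s div int p))"
        using cf(1)[of n d] by (simp add: x_def s_def sum_subtractf sum_distrib_left sum_negf)
      finally show "int p dvd (\<Sum>i<k. cf i * (x i ^ s mod int p))" by simp
    qed
    then show "int T dvd (\<Sum>i<k. cf i * int (g (n + a ! i * d)))" by (simp add: x_def)
  qed
  \<comment> \<open>Each residue class modulo \<open>Q\<close> contains exactly \<open>p\<close> of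
    the differences \<open>d\<close>.\<close>
  have count: "(\<Sum>d\<in>{0..<int N}. if d mod int Q \<in> Bad then 1 else 0 :: real) = real p * real (card Bad)"
  proof -
    have "(\<Sum>d\<in>{0..<int N}. if d mod int Q \<in> Bad then 1 else 0 :: real) =
        (\<Sum>\<kappa><Q. \<Sum>t<p. if (int \<kappa> + int Q * int t) mod int Q \<in> Bad then 1 else 0)"
      unfolding N_def by (rule sum_int_periodic_split)
    also have "\<dots> = (\<Sum>\<kappa><Q. real p * (if int \<kappa> \<in> Bad then 1 else 0))"
      by (intro sum.cong refl) simp
    also have "\<dots> = real p * (\<Sum>\<kappa>\<in>{0..<int Q}. if \<kappa> \<in> Bad then 1 else 0)"
      unfolding sum_distrib_left[symmetric]
      by (intro arg_cong[of _ _ "\<lambda>y. real p * y"] sum.reindex_bij_witness[of _ nat int]) auto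
    also have "(\<Sum>\<kappa>\<in>{0..<int Q}. if \<kappa> \<in> Bad then 1 else 0 :: real) = real (card Bad)"
      using Bad(1) by (simp add: sum.If_cases Int_absorb1)
    finally show ?thesis .
  qed
  have "Re (AP_count (integer_mod_group N) a (indicator A)) \<le>
      (\<Sum>n\<in>{0..<int N}. \<Sum>d\<in>{0..<int N}. if d mod int Q \<in> Bad then 1 else 0) / real N ^ 2"
    unfolding AP_count_Re[OF N0] using bad by (intro divide_right_mono sum_mono) auto
  also have "\<dots> = real (card Bad) / real Q"
    unfolding count using Q p0 by (simp add: N_def power2_eq_square field_simps)
  finally have "Re (AP_count (integer_mod_group N) a (indicator A)) \<le> real (card Bad) / real Q" .
  moreover have "A \<subseteq> carrier (integer_mod_group N)"
    using N0 by (auto simp: A_def carrier_integer_mod_group)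
  moreover have "N \<ge> N0"
    using p(2) Q by (simp add: N_def) (metis add_leE less_imp_le_nat mult_le_mono nat_mult_1 Suc_leI One_nat_def)
  ultimately show ?thesis using gow unfolding s_def by blast
qed

section \<open>From sets with few progressions to a bound on \<open>rho\<close>\<close>

lemma AP_lower_boundE:
  assumes "AP_lower_bound a \<alpha> \<rho>" "\<epsilon> > 0"
  obtains \<eta> N0 where "\<eta> > 0"
    "\<And>N A. N \<ge> N0 \<Longrightarrow> A \<subseteq> carrier (integer_mod_group N) \<Longrightarrow>
      gowers_norm (integer_mod_group N) (length a - 2) (\<lambda>x. indicator A x - complex_of_real \<alpha>) \<le> \<eta> \<Longrightarrow>
      Re (AP_count (integer_mod_group N) a (indicator A)) \<ge> \<rho> - \<epsilon>"
proof -
  obtain \<eta> N0 where "\<eta> > 0" and N0: "\<forall>N\<ge>N0. \<forall>A\<subseteq>carrier (integer_mod_group N).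
      gowers_norm (integer_mod_group N) (length a - 2) (\<lambda>x. indicator A x - complex_of_real \<alpha>) \<le> \<eta> \<longrightarrow>
      Re (AP_count (integer_mod_group N) a (indicator A)) \<ge> \<rho> - \<epsilon>"
    using assms(1)[unfolded AP_lower_bound_def, THEN spec, THEN mp, OF assms(2)]
    by blast
  show thesis by (rule that[OF \<open>\<eta> > 0\<close> N0[rule_format]])
qed

text \<open>\<open>GREATEST\<close> is informative only if a greatest admissible value exists. The
  admissible values include \<open>0\<close>, are bounded by \<open>B\<close>, and contain their
  supremum, as one sees by halving \<open>\<epsilon>\<close>.\<close>

lemma rho_le:
  assumes sets: "\<And>\<eta> N0. \<eta> > 0 \<Longrightarrow> \<exists>N\<ge>N0. \<exists>A\<subseteq>carrier (integer_mod_group N).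
    gowers_norm (integer_mod_group N) (length a - 2) (\<lambda>x. indicator A x - complex_of_real \<alpha>) \<le> \<eta> \<and>
    Re (AP_count (integer_mod_group N) a (indicator A)) \<le> B"
  shows "rho a \<alpha> \<le> B"
proof -
  have upper: "\<rho> \<le> B" if "AP_lower_bound a \<alpha> \<rho>" for \<rho>
  proof (rule field_le_epsilon)
    fix \<epsilon> :: real assume "\<epsilon> > 0"
    with that obtain \<eta> N0 where "\<eta> > 0" and N0: "\<And>N A. N \<ge> N0 \<Longrightarrow> A \<subseteq> carrier (integer_mod_group N) \<Longrightarrow>
      gowers_norm (integer_mod_group N) (length a - 2) (\<lambda>x. indicator A x - complex_of_real \<alpha>) \<le> \<eta> \<Longrightarrow>
      Re (AP_count (integer_mod_group N) a (indicator A)) \<ge> \<rho> - \<epsilon>"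
      by (rule AP_lower_boundE) blast
    obtain N A where "N \<ge> N0" "A \<subseteq> carrier (integer_mod_group N)"
      "gowers_norm (integer_mod_group N) (length a - 2) (\<lambda>x. indicator A x - complex_of_real \<alpha>) \<le> \<eta>"
      and B: "Re (AP_count (integer_mod_group N) a (indicator A)) \<le> B"
      using sets[OF \<open>\<eta> > 0\<close>, of N0] by blast
    from N0[OF this(1-3)] B show "\<rho> \<le> B + \<epsilon>" by linarith
  qed
  define S where "S = {\<rho>. AP_lower_bound a \<alpha> \<rho>}"
  have bdd: "bdd_above S" using upper by (auto simp: S_def bdd_above_def)
  have "AP_lower_bound a \<alpha> 0"
    unfolding AP_lower_bound_def
  proof (intro allI impI)
    fix \<epsilon> :: real assume "\<epsilon> > 0"
    \<comment> \<open>\<open>N \<ge> 1\<close> excludes \<open>integer_mod_group 0\<close>, the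
      infinite group of integers.\<close>
    have "Re (AP_count (integer_mod_group N) a (indicator A)) \<ge> 0 - \<epsilon>" if "N \<ge> 1" for N A
    proof -
      have "Re (AP_count (integer_mod_group N) a (indicator A)) \<ge> 0"
        using that by (subst AP_count_Re) (auto intro!: divide_nonneg_nonneg sum_nonneg)
      then show ?thesis using \<open>\<epsilon> > 0\<close> by linarith
    qed
    then show "\<exists>\<eta>>0. \<exists>N\<^sub>0. \<forall>N\<ge>N\<^sub>0. \<forall>A\<subseteq>carrier (integer_mod_group N).
        gowers_norm (integer_mod_group N) (length a - 2) (\<lambda>x. indicator A x - complex_of_real \<alpha>) \<le> \<eta> \<longrightarrow>
        0 - \<epsilon> \<le> Re (AP_count (integer_mod_group N) a (indicator A))"
      by (intro exI[of _ 1]) auto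
  qed
  then have "S \<noteq> {}" by (auto simp: S_def)
  have "AP_lower_bound a \<alpha> (Sup S)"
    unfolding AP_lower_bound_def
  proof (intro allI impI)
    fix \<epsilon> :: real assume "\<epsilon> > 0"
    then obtain \<rho> where \<rho>: "\<rho> \<in> S" "Sup S - \<epsilon> / 2 < \<rho>"
      using less_cSup_iff[OF \<open>S \<noteq> {}\<close> bdd, of "Sup S - \<epsilon> / 2"] by auto
    have "AP_lower_bound a \<alpha> \<rho>" using \<rho>(1) by (simp add: S_def)
    then obtain \<eta> N0 where "\<eta> > 0" and N0: "\<And>N A. N \<ge> N0 \<Longrightarrow> A \<subseteq> carrier (integer_mod_group N) \<Longrightarrow>
      gowers_norm (integer_mod_group N) (length a - 2) (\<lambda>x. indicator A x - complex_of_real \<alpha>) \<le> \<eta> \<Longrightarrow>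
      Re (AP_count (integer_mod_group N) a (indicator A)) \<ge> \<rho> - \<epsilon> / 2"
      by (rule AP_lower_boundE[OF _ half_gt_zero[OF \<open>\<epsilon> > 0\<close>]]) blast
    show "\<exists>\<eta>>0. \<exists>N\<^sub>0. \<forall>N\<ge>N\<^sub>0. \<forall>A\<subseteq>carrier (integer_mod_group N).
        gowers_norm (integer_mod_group N) (length a - 2) (\<lambda>x. indicator A x - complex_of_real \<alpha>) \<le> \<eta> \<longrightarrow>
        Sup S - \<epsilon> \<le> Re (AP_count (integer_mod_group N) a (indicator A))"
    proof (rule exI[of _ \<eta>], intro conjI exI[of _ N0] allI impI \<open>\<eta> > 0\<close>)
      fix N A assume "N0 \<le> N" "A \<subseteq> carrier (integer_mod_group N)"
        "gowers_norm (integer_mod_group N) (length a - 2) (\<lambda>x. indicator A x - complex_of_real \<alpha>) \<le> \<eta>"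
      from N0[OF this] \<rho>(2) show "Sup S - \<epsilon> \<le> Re (AP_count (integer_mod_group N) a (indicator A))"
        by linarith
    qed
  qed
  then have "rho a \<alpha> = Sup S"
    unfolding rho_def using bdd by (intro Greatest_equality) (auto simp: S_def intro: cSup_upper)
  then show ?thesis using upper \<open>AP_lower_bound a \<alpha> (Sup S)\<close> by simp
qed

theorem theorem1p22:
  fixes k :: nat and a :: "int list" and r :: "nat \<Rightarrow> nat" and C :: real
  assumes "k \<ge> 4" and "even k"
    and "length a = k" and "symmetric_tuple a" and "sorted_wrt (<) a"
    and "\<And>N. N \<ge> 1 \<Longrightarrow> r N \<ge> 1"
    and "(\<lambda>N. ln (real (r N)) / ln (real N)) \<longlonglongrightarrow> 0"
    and "\<And>N. N \<ge> 1 \<Longrightarrow> \<exists>c. c ` {1..int N} \<subseteq> {..<r N} \<and> \<not> (\<exists>n d. sym_colored_AP a c N n d)"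
    and "C > 0"
  shows "\<forall>\<^sub>F \<alpha> in at_right 0. rho a \<alpha> < \<alpha> powr C"
proof -
  have "k \<ge> 3" using assms(1) by simp
  then obtain cf :: "nat \<Rightarrow> int" where cf: "\<And>i. i < k \<Longrightarrow> cf i \<noteq> 0"
    "\<And>n d s. s + 2 \<le> k \<Longrightarrow> (\<Sum>i<k. cf i * (n + a ! i * d) ^ s) = 0"
    "\<And>m. 0 < m \<Longrightarrow> m < k \<Longrightarrow> (\<Sum>i\<in>{m..<k}. cf i) \<noteq> 0"
    using relation_coefficients_exist[OF assms(5) assms(3)[symmetric]] by blast
  have sum0: "(\<Sum>i<k. cf i) = 0" using cf(2)[of 0] assms by simp
  \<comment> \<open>The largest exponent that \<open>cf(2)\<close> admits, equal to the order of the
    uniformity norm.\<close>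
  have top: "(\<Sum>i<k. cf i * (n + a ! i * d) ^ (k - 2)) = 0" for n d
    by (rule cf(2)) (use assms(1) in simp)
  have "\<forall>\<^sub>F \<alpha>::real in at_right 0. \<alpha> > 0" by (rule eventually_at_right_less)
  moreover have "\<forall>\<^sub>F \<alpha> in at_right 0. \<exists>(Q::nat) (T::nat) (g :: int \<Rightarrow> nat) Bad.
    Q > 0 \<and> (\<forall>x. g x < T) \<and> (\<forall>x. g (x + int Q) = g x) \<and>
    \<alpha> * real T * real_of_int (\<Sum>i<k. \<bar>cf i\<bar>) < 1 \<and>
    Bad \<subseteq> {0..<int Q} \<and> real (card Bad) / real Q \<le> \<alpha> powr C / 2 \<and>
    (\<forall>n d. int T dvd (\<Sum>i<k. cf i * int (g (n + a ! i * d))) \<longrightarrow> d mod int Q \<in> Bad)"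
    using assms(1,3) by (intro coloring_parameters[OF assms(5,4) _ _ cf(1) sum0 cf(3) assms(8,6,7,9)]) auto
  ultimately show ?thesis
  proof eventually_elim
    case (elim \<alpha>)
    have "\<alpha> > 0" by (rule elim(1))
    obtain Q T :: nat and g :: "int \<Rightarrow> nat" and Bad where
      Q: "Q > 0" and g: "\<And>x. g x < T" "\<And>x. g (x + int Q) = g x" and
      small: "\<alpha> * real T * real_of_int (\<Sum>i<k. \<bar>cf i\<bar>) < 1" and
      Bad: "Bad \<subseteq> {0..<int Q}" "real (card Bad) / real Q \<le> \<alpha> powr C / 2" and
      bad: "\<And>n d. int T dvd (\<Sum>i<k. cf i * int (g (n + a ! i * d))) \<Longrightarrow> d mod int Q \<in> Bad"
      using elim(2) by blast
    have "rho a \<alpha> \<le> real (card Bad) / real Q"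
    proof (rule rho_le)
      fix \<eta> :: real and N0 :: nat assume "\<eta> > 0"
      have "\<exists>i<k. cf i \<noteq> 0" using cf(1)[of 0] assms(1) by (intro exI[of _ 0]) auto
      then show "\<exists>N\<ge>N0. \<exists>A\<subseteq>carrier (integer_mod_group N).
        gowers_norm (integer_mod_group N) (length a - 2) (\<lambda>x. indicator A x - complex_of_real \<alpha>) \<le> \<eta> \<and>
        Re (AP_count (integer_mod_group N) a (indicator A)) \<le> real (card Bad) / real Q"
        unfolding assms(3)
        by (rule uniform_set_with_few_APs[where k = k and a = a and cf = cf and Q = Q and T = T and g = g
              and \<alpha> = \<alpha> and Bad = Bad and \<eta> = \<eta>,
              OF assms(3)[symmetric] \<open>k \<ge> 3\<close> top _ Q g small \<open>\<alpha> > 0\<close> Bad(1) bad \<open>\<eta> > 0\<close>])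
    qed
    also have "\<dots> < \<alpha> powr C"
    proof -
      have "\<alpha> powr C > 0" using \<open>\<alpha> > 0\<close> by simp
      then show ?thesis using Bad(2) by linarith
    qed
    finally show ?case .
  qed
qed

end
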